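(* Let $Q$ be a smooth $n$-dimensional manifold, let $L\in C^\infty(TQ)$ be a regular Lagrangian, and let $X\colon Q\to TQ$ be a vector field on $Q$. Then $X$ is a solution of the generalized Lagrangian Hamilton--Jacobi problem for $L$ if, and only if, $$i(X)(X^*\omega_L)=d(X^*E_L).$$
   Context: Let $\tau_Q\colon TQ\to Q$ be the tangent bundle, with natural coordinates $(q^i,v^i)$. For $L\in C^\infty(TQ)$, the Cartan 1-form is $\theta_L=\frac{\partial L}{\partial v^i}\,dq^i$ (that is, $dL\circ S$, with $S=\frac{\partial}{\partial v^i}\otimes dq^i$ the vertical endomorphism), the Cartan 2-form is $\omega_L=-d\theta_L$, and the energy is $E_L=\Delta(L)-L$, where $\Delta=v^i\frac{\partial}{\partial v^i}$ is the Liouville vector field. $L$ is regular if $\omega_L$ is symplectic; in that case $\Gamma_L$ denotes the unique vector field on $TQ$ with $i(\Gamma_L)\omega_L=dE_L$ (it is a second order differential equation field, i.e. $T\tau_Q\circ\Gamma_L=\mathrm{Id}_{TQ}$). A vector field $X$ on $Q$ is regarded as a smooth map $X\colon Q\to TQ$ with $\tau_Q\circ X=\mathrm{Id}_Q$, and $X^*$ denotes pull-back along this map. $X$ is a solution of the generalized Lagrangian Hamilton--Jacobi problem if for every integral curve $\gamma$ of $X$ (a curve in $Q$ defined on an open interval with $\dot\gamma=X\circ\gamma$), the curve $\dot\gamma=X\circ\gamma$ in $TQ$ is an integral curve of $\Gamma_L$. *)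

theory Defs
  imports "HOL-Analysis.Analysis"
begin

primrec Ck_on :: "nat \<Rightarrow> 'e::euclidean_space set \<Rightarrow> ('e \<Rightarrow> 'f::real_normed_vector) \<Rightarrow> bool" where
  "Ck_on 0 S f \<longleftrightarrow> continuous_on S f"
| "Ck_on (Suc k) S f \<longleftrightarrow> (\<forall>x\<in>S. f differentiable (at x)) \<and>
     (\<forall>v. Ck_on k S (\<lambda>x. frechet_derivative f (at x) v))"

definition smooth_on :: "'e::euclidean_space set \<Rightarrow> ('e \<Rightarrow> 'f::real_normed_vector) \<Rightarrow> bool" where
  "smooth_on S f \<longleftrightarrow> (\<forall>k. Ck_on k S f)"

text \<open>A chart is a domain together with a coordinate map; the values of the coordinate map
  outside the domain are irrelevant.  A manifold is a topology with a (not necessarily maximal)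
  smooth atlas; the model space \<open>'e\<close> fixes the dimension.\<close>

type_synonym ('a, 'e) chart = "'a set \<times> ('a \<Rightarrow> 'e)"

abbreviation cdom :: "('a, 'e) chart \<Rightarrow> 'a set" where "cdom \<equiv> fst"
abbreviation cmap :: "('a, 'e) chart \<Rightarrow> 'a \<Rightarrow> 'e" where "cmap \<equiv> snd"

definition cinv :: "('a, 'e) chart \<Rightarrow> 'e \<Rightarrow> 'a" where
  "cinv c = inv_into (cdom c) (cmap c)"

record ('a, 'e) mfd =
  mtop :: "'a topology"
  atlas :: "('a, 'e) chart set"

abbreviation points :: "('a, 'e) mfd \<Rightarrow> 'a set" where "points M \<equiv> topspace (mtop M)"

definition charts_at :: "('a, 'e) mfd \<Rightarrow> 'a \<Rightarrow> ('a, 'e) chart set" where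
  "charts_at M p = {c \<in> atlas M. p \<in> cdom c}"

definition smooth_manifold :: "('a, 'e::euclidean_space) mfd \<Rightarrow> bool" where
  "smooth_manifold M \<longleftrightarrow>
     Hausdorff_space (mtop M) \<and> second_countable (mtop M) \<and>
     (\<Union>c\<in>atlas M. cdom c) = points M \<and>
     (\<forall>c\<in>atlas M. openin (mtop M) (cdom c) \<and> open (cmap c ` cdom c) \<and>
        homeomorphic_map (subtopology (mtop M) (cdom c)) (top_of_set (cmap c ` cdom c)) (cmap c)) \<and>
     (\<forall>c\<in>atlas M. \<forall>c'\<in>atlas M.
        smooth_on (cmap c ` (cdom c \<inter> cdom c')) (cmap c' \<circ> cinv c))"

definition smooth_fun :: "('a, 'e::euclidean_space) mfd \<Rightarrow> ('a \<Rightarrow> real) \<Rightarrow> bool" where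
  "smooth_fun M f \<longleftrightarrow> (\<forall>c\<in>atlas M. smooth_on (cmap c ` cdom c) (f \<circ> cinv c))"

definition smooth_map ::
  "('a, 'e::euclidean_space) mfd \<Rightarrow> ('b, 'f::euclidean_space) mfd \<Rightarrow> ('a \<Rightarrow> 'b) \<Rightarrow> bool" where
  "smooth_map M N F \<longleftrightarrow> continuous_map (mtop M) (mtop N) F \<and>
     (\<forall>c\<in>atlas M. \<forall>c'\<in>atlas N.
        smooth_on (cmap c ` {p \<in> cdom c. F p \<in> cdom c'}) (cmap c' \<circ> F \<circ> cinv c))"

text \<open>A tangent vector at \<open>p\<close> is a family of components, one for each chart around \<open>p\<close>, that
  transforms by the Jacobians of the chart changes; it is set to 0 at all other charts, so that
  equality of tangent vectors is equality of functions.\<close>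

type_synonym ('a, 'e) tvec = "('a, 'e) chart \<Rightarrow> 'e"

definition tspace :: "('a, 'e::euclidean_space) mfd \<Rightarrow> 'a \<Rightarrow> ('a, 'e) tvec set" where
  "tspace M p = {v. (\<forall>c. c \<notin> charts_at M p \<longrightarrow> v c = 0) \<and>
     (\<forall>c\<in>charts_at M p. \<forall>c'\<in>charts_at M p.
        v c' = frechet_derivative (cmap c' \<circ> cinv c) (at (cmap c p)) (v c))}"

text \<open>The tangent vector at \<open>p\<close> with component \<open>h\<close> in the chart \<open>c\<close>.\<close>

definition coord_vec ::
  "('a, 'e::euclidean_space) mfd \<Rightarrow> 'a \<Rightarrow> ('a, 'e) chart \<Rightarrow> 'e \<Rightarrow> ('a, 'e) tvec" where
  "coord_vec M p c h = (\<lambda>c'. if c' \<in> charts_at M p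
     then frechet_derivative (cmap c' \<circ> cinv c) (at (cmap c p)) h else 0)"

text \<open>The chart of the tangent bundle with the natural coordinates \<open>(q, v)\<close> induced by a chart
  of the base.\<close>

definition tchart ::
  "('a, 'e::euclidean_space) mfd \<Rightarrow> ('a, 'e) chart \<Rightarrow> ('a \<times> ('a, 'e) tvec, 'e \<times> 'e) chart" where
  "tchart M c = ({(p, v). p \<in> cdom c \<and> v \<in> tspace M p}, \<lambda>(p, v). (cmap c p, v c))"

definition tbundle ::
  "('a, 'e::euclidean_space) mfd \<Rightarrow> ('a \<times> ('a, 'e) tvec, 'e \<times> 'e) mfd" where
  "tbundle M = \<lparr>
     mtop = topology_generated_by
       {{u \<in> cdom (tchart M c). cmap (tchart M c) u \<in> W} | c W. c \<in> atlas M \<and> open W},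
     atlas = tchart M ` atlas M\<rparr>"

text \<open>In the following definitions the auxiliary chart is arbitrary: by the chain rule nothing
  depends on its choice as long as the data are smooth.\<close>

definition some_chart :: "('a, 'e) mfd \<Rightarrow> 'a \<Rightarrow> ('a, 'e) chart" where
  "some_chart M p = (SOME c. c \<in> charts_at M p)"

definition tmap :: "('a, 'e::euclidean_space) mfd \<Rightarrow> ('b, 'f::euclidean_space) mfd \<Rightarrow>
    ('a \<Rightarrow> 'b) \<Rightarrow> 'a \<Rightarrow> ('a, 'e) tvec \<Rightarrow> ('b, 'f) tvec" where
  "tmap M N F p v = (let c = some_chart M p in
     (\<lambda>c'. if c' \<in> charts_at N (F p)
       then frechet_derivative (cmap c' \<circ> F \<circ> cinv c) (at (cmap c p)) (v c) else 0))"

definition vector_field ::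
  "('a, 'e::euclidean_space) mfd \<Rightarrow> ('a \<Rightarrow> 'a \<times> ('a, 'e) tvec) \<Rightarrow> bool" where
  "vector_field M X \<longleftrightarrow> smooth_map M (tbundle M) X \<and> (\<forall>p\<in>points M. fst (X p) = p)"

definition differentiable_curve ::
  "('a, 'e::euclidean_space) mfd \<Rightarrow> real set \<Rightarrow> (real \<Rightarrow> 'a) \<Rightarrow> bool" where
  "differentiable_curve M I \<gamma> \<longleftrightarrow> continuous_map (top_of_set I) (mtop M) \<gamma> \<and>
     (\<forall>t\<in>I. \<forall>c\<in>charts_at M (\<gamma> t). (cmap c \<circ> \<gamma>) differentiable (at t))"

definition velocity ::
  "('a, 'e::euclidean_space) mfd \<Rightarrow> (real \<Rightarrow> 'a) \<Rightarrow> real \<Rightarrow> 'a \<times> ('a, 'e) tvec" where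
  "velocity M \<gamma> t = (\<gamma> t, \<lambda>c. if c \<in> charts_at M (\<gamma> t)
     then vector_derivative (cmap c \<circ> \<gamma>) (at t) else 0)"

text \<open>Integral curves of smooth vector fields are automatically smooth, so only
  differentiability is required.\<close>

definition integral_curve :: "('a, 'e::euclidean_space) mfd \<Rightarrow> ('a \<Rightarrow> 'a \<times> ('a, 'e) tvec) \<Rightarrow>
    real set \<Rightarrow> (real \<Rightarrow> 'a) \<Rightarrow> bool" where
  "integral_curve M X I \<gamma> \<longleftrightarrow> open I \<and> is_interval I \<and> differentiable_curve M I \<gamma> \<and>
     (\<forall>t\<in>I. velocity M \<gamma> t = X (\<gamma> t))"

text \<open>A \<open>k\<close>-form sends a point and a list of \<open>k\<close> tangent vectors at it to a number; its values on
  other lists are irrelevant, and equality of forms is relativised accordingly.\<close>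

type_synonym ('a, 'e) form = "'a \<Rightarrow> ('a, 'e) tvec list \<Rightarrow> real"

definition form_eq ::
  "('a, 'e::euclidean_space) mfd \<Rightarrow> nat \<Rightarrow> ('a, 'e) form \<Rightarrow> ('a, 'e) form \<Rightarrow> bool" where
  "form_eq M k \<alpha> \<beta> \<longleftrightarrow>
     (\<forall>p\<in>points M. \<forall>vs. length vs = k \<and> set vs \<subseteq> tspace M p \<longrightarrow> \<alpha> p vs = \<beta> p vs)"

definition smooth_form :: "('a, 'e::euclidean_space) mfd \<Rightarrow> nat \<Rightarrow> ('a, 'e) form \<Rightarrow> bool" where
  "smooth_form M k \<alpha> \<longleftrightarrow>
     (\<forall>p\<in>points M. \<forall>vs. length vs = k \<and> set vs \<subseteq> tspace M p \<longrightarrow>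
        (\<forall>i<k. \<forall>v\<in>tspace M p. \<forall>w\<in>tspace M p. \<forall>a b.
           \<alpha> p (vs[i := (\<lambda>c. a *\<^sub>R v c + b *\<^sub>R w c)]) = a * \<alpha> p (vs[i := v]) + b * \<alpha> p (vs[i := w])) \<and>
        (\<forall>i<k. \<forall>j<k. i \<noteq> j \<and> vs ! i = vs ! j \<longrightarrow> \<alpha> p vs = 0)) \<and>
     (\<forall>c\<in>atlas M. \<forall>hs. length hs = k \<longrightarrow>
        smooth_on (cmap c ` cdom c) (\<lambda>x. \<alpha> (cinv c x) (map (coord_vec M (cinv c x) c) hs)))"

abbreviation fun_form :: "('a \<Rightarrow> real) \<Rightarrow> ('a, 'e) form" where
  "fun_form f \<equiv> (\<lambda>p vs. f p)"

text \<open>The exterior derivative: in a chart,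
  \<open>(d\<alpha>)(v\<^sub>0, \<dots>, v\<^sub>k) = \<Sum>\<^sub>i (-1)\<^sup>i D(\<alpha>(v\<^sub>0, \<dots>, v\<^sub>i omitted, \<dots>, v\<^sub>k)) v\<^sub>i\<close>,
  where the vectors \<open>v\<^sub>j\<close> are extended with constant components.\<close>

definition ext_deriv :: "('a, 'e::euclidean_space) mfd \<Rightarrow> ('a, 'e) form \<Rightarrow> ('a, 'e) form" where
  "ext_deriv M \<alpha> p vs = (let c = some_chart M p in
     (\<Sum>i<length vs. (- 1) ^ i *
        frechet_derivative
          (\<lambda>x. \<alpha> (cinv c x) (map (\<lambda>v. coord_vec M (cinv c x) c (v c)) (take i vs @ drop (Suc i) vs)))
          (at (cmap c p)) ((vs ! i) c)))"

definition contract :: "('a \<Rightarrow> 'a \<times> ('a, 'e) tvec) \<Rightarrow> ('a, 'e) form \<Rightarrow> ('a, 'e) form" where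
  "contract X \<alpha> p vs = \<alpha> p (snd (X p) # vs)"

definition pullback :: "('a, 'e::euclidean_space) mfd \<Rightarrow> ('b, 'f::euclidean_space) mfd \<Rightarrow>
    ('a \<Rightarrow> 'b) \<Rightarrow> ('b, 'f) form \<Rightarrow> ('a, 'e) form" where
  "pullback M N F \<alpha> p vs = \<alpha> (F p) (map (tmap M N F p) vs)"

definition symplectic_form :: "('a, 'e::euclidean_space) mfd \<Rightarrow> ('a, 'e) form \<Rightarrow> bool" where
  "symplectic_form M \<omega> \<longleftrightarrow> smooth_form M 2 \<omega> \<and>
     form_eq M 3 (ext_deriv M \<omega>) (\<lambda>p vs. 0) \<and>
     (\<forall>p\<in>points M. \<forall>v\<in>tspace M p. (\<forall>w\<in>tspace M p. \<omega> p [v, w] = 0) \<longrightarrow> v = (\<lambda>c. 0))"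

type_synonym ('a, 'e) tpoint = "'a \<times> ('a, 'e) tvec"

text \<open>All charts of \<open>tbundle M\<close> are of the form \<open>tchart M c\<close>, so components of tangent vectors to
  the tangent bundle are pairs: the coefficients of the \<open>\<partial>/\<partial>q\<^sup>i\<close> and those of the
  \<open>\<partial>/\<partial>v\<^sup>i\<close>.\<close>

definition vertical_endo ::
  "(('a, 'e::euclidean_space) tpoint, 'e \<times> 'e) tvec \<Rightarrow> (('a, 'e) tpoint, 'e \<times> 'e) tvec" where
  "vertical_endo w = (\<lambda>c. (0, fst (w c)))"

definition liouville :: "('a, 'e::euclidean_space) mfd \<Rightarrow> ('a, 'e) tpoint \<Rightarrow>
    ('a, 'e) tpoint \<times> (('a, 'e) tpoint, 'e \<times> 'e) tvec" where
  "liouville M u =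
     (u, \<lambda>c. if c \<in> charts_at (tbundle M) u then (0, snd (cmap c u)) else 0)"

definition cartan_1form :: "('a, 'e::euclidean_space) mfd \<Rightarrow> (('a, 'e) tpoint \<Rightarrow> real) \<Rightarrow>
    (('a, 'e) tpoint, 'e \<times> 'e) form" where
  "cartan_1form M L u ws = ext_deriv (tbundle M) (fun_form L) u (map vertical_endo ws)"

definition cartan_2form :: "('a, 'e::euclidean_space) mfd \<Rightarrow> (('a, 'e) tpoint \<Rightarrow> real) \<Rightarrow>
    (('a, 'e) tpoint, 'e \<times> 'e) form" where
  "cartan_2form M L u ws = - ext_deriv (tbundle M) (cartan_1form M L) u ws"

definition energy :: "('a, 'e::euclidean_space) mfd \<Rightarrow> (('a, 'e) tpoint \<Rightarrow> real) \<Rightarrow>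
    ('a, 'e) tpoint \<Rightarrow> real" where
  "energy M L u = contract (liouville M) (ext_deriv (tbundle M) (fun_form L)) u [] - L u"

definition regular_lagrangian ::
  "('a, 'e::euclidean_space) mfd \<Rightarrow> (('a, 'e) tpoint \<Rightarrow> real) \<Rightarrow> bool" where
  "regular_lagrangian M L \<longleftrightarrow>
     smooth_fun (tbundle M) L \<and> symplectic_form (tbundle M) (cartan_2form M L)"

text \<open>The field \<open>\<Gamma>\<^sub>L\<close>.  The equation \<open>i(\<Gamma>\<^sub>L)\<omega>\<^sub>L = dE\<^sub>L\<close> is pointwise and, when \<open>\<omega>\<^sub>L\<close> is
  nondegenerate, has exactly one solution among all sections of the tangent bundle of \<open>tbundle M\<close>
  (up to irrelevant values off the manifold); as \<open>\<omega>\<^sub>L\<close> and \<open>dE\<^sub>L\<close> are smooth, so is that section, and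
  there is no need to ask for smoothness.\<close>

definition lagrangian_field :: "('a, 'e::euclidean_space) mfd \<Rightarrow> (('a, 'e) tpoint \<Rightarrow> real) \<Rightarrow>
    ('a, 'e) tpoint \<Rightarrow> ('a, 'e) tpoint \<times> (('a, 'e) tpoint, 'e \<times> 'e) tvec" where
  "lagrangian_field M L = (SOME \<Gamma>.
     (\<forall>u\<in>points (tbundle M). fst (\<Gamma> u) = u \<and> snd (\<Gamma> u) \<in> tspace (tbundle M) u) \<and>
     form_eq (tbundle M) 1 (contract \<Gamma> (cartan_2form M L))
       (ext_deriv (tbundle M) (fun_form (energy M L))))"

definition hamilton_jacobi_solution :: "('a, 'e::euclidean_space) mfd \<Rightarrow>
    (('a, 'e) tpoint \<Rightarrow> real) \<Rightarrow> ('a \<Rightarrow> ('a, 'e) tpoint) \<Rightarrow> bool" where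
  "hamilton_jacobi_solution M L X \<longleftrightarrow>
     (\<forall>I \<gamma>. integral_curve M X I \<gamma> \<longrightarrow>
        integral_curve (tbundle M) (lagrangian_field M L) I (X \<circ> \<gamma>))"

end

theory Submission imports Defs begin

text \<open>Along an integral curve \<open>\<gamma>\<close> of \<open>X\<close>, the curve \<open>X \<circ> \<gamma>\<close> has velocity \<open>TX \<circ> X\<close>; as an integral curve
  passes through every point, \<open>X\<close> solves the Hamilton--Jacobi problem iff \<open>TX \<circ> X = \<Gamma>\<^sub>L \<circ> X\<close>.  By
  naturality and \<open>dE\<^sub>L = i(\<Gamma>\<^sub>L)\<omega>\<^sub>L\<close>, the equation of forms says that \<open>D = TX \<circ> X - \<Gamma>\<^sub>L \<circ> X\<close> is
  \<open>\<omega>\<^sub>L\<close>-orthogonal to the image of \<open>TX\<close>.  Since \<open>\<Gamma>\<^sub>L\<close> is a second order field, \<open>D\<close> is vertical, so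
  it is orthogonal to the vertical space as well; the two spaces span, hence \<open>D = 0\<close> by
  nondegeneracy.\<close>

subsection \<open>Calculus\<close>

text \<open>On the right-hand side \<open>d\<close> acts on the pull-back of a function, so
  naturality is the chain rule; the left-hand side is pointwise algebra. The Cartan 2-form is always
  read off in the chart chosen by \<open>ext_deriv\<close>, as
  \<open>hess u (fst v) w - hess u (fst w) v\<close>. From this formula the vertical space is
  isotropic, and testing on vertical vectors shows the fibre Hessian to be nondegenerate, which is
  the source of the second order property. Passing from curves to points rests on a local existence
  theorem for differential equations, applied in one chart; the velocity must then be checked in all
  charts, because a tangent vector is stored as the family of all its components. Smoothness is
  stored as iterated derivatives in fixed directions, so derivatives in moving directions are
  expanded in the basis.\<close>

lemma frechet_derivative_eqI:
  "(f has_derivative F) (at x) \<Longrightarrow> frechet_derivative f (at x) h = F h"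
  by (simp flip: frechet_derivative_at)

text \<open>\<open>Ck_on\<close> controls the derivative one fixed direction at a time. The
  expansion turns a derivative in a varying direction into a finite sum of such functions with
  scalar coefficients.\<close>

lemma derivative_eq_sum_Basis:
  fixes g :: "'e::euclidean_space \<Rightarrow> 'f::real_normed_vector"
  assumes "g differentiable (at y)"
  shows "frechet_derivative g (at y) w = (\<Sum>i\<in>Basis. (w \<bullet> i) *\<^sub>R frechet_derivative g (at y) i)"
proof -
  interpret bounded_linear "frechet_derivative g (at y)"
    using assms by (simp add: frechet_derivative_works has_derivative_bounded_linear)
  have "frechet_derivative g (at y) w = frechet_derivative g (at y) (\<Sum>i\<in>Basis. (w \<bullet> i) *\<^sub>R i)"
    by (simp add: euclidean_representation)
  also have "\<dots> = (\<Sum>i\<in>Basis. (w \<bullet> i) *\<^sub>R frechet_derivative g (at y) i)"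
    by (simp only: sum scaleR)
  finally show ?thesis .
qed

text \<open>The basis expansion holds near \<open>x\<close>, so it may be differentiated once more;
  the coordinates of \<open>w\<close> are constants there, and linearity in \<open>w\<close> is
  visible in the resulting sum.\<close>

lemma second_derivative_linear:
  fixes g :: "'e::euclidean_space \<Rightarrow> 'f::real_normed_vector"
  assumes C2: "Ck_on 2 S g" and "open S" and "x \<in> S"
  defines "D2 \<equiv> \<lambda>w h. frechet_derivative (\<lambda>y. frechet_derivative g (at y) w) (at x) h"
  shows "D2 w h = (\<Sum>i\<in>Basis. (w \<bullet> i) *\<^sub>R D2 i h)" and "linear (\<lambda>w. D2 w h)"
proof -
  have d1: "g differentiable (at y)" if "y \<in> S" for y
    using C2 that by (simp add: numeral_2_eq_2)
  have d2: "(\<lambda>y. frechet_derivative g (at y) w) differentiable (at x)" for w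
    using C2 \<open>x \<in> S\<close> by (simp add: numeral_2_eq_2)
  have "((\<lambda>y. \<Sum>i\<in>Basis. (w \<bullet> i) *\<^sub>R frechet_derivative g (at y) i) has_derivative
      (\<lambda>h. \<Sum>i\<in>Basis. (w \<bullet> i) *\<^sub>R D2 i h)) (at x)" for w
    unfolding D2_def using d2
    by (intro derivative_intros) (simp add: frechet_derivative_works[symmetric])
  then have "((\<lambda>y. frechet_derivative g (at y) w) has_derivative
      (\<lambda>h. \<Sum>i\<in>Basis. (w \<bullet> i) *\<^sub>R D2 i h)) (at x)" for w
    by (rule has_derivative_transform_within_open[OF _ \<open>open S\<close> \<open>x \<in> S\<close>])
      (simp add: derivative_eq_sum_Basis[OF d1, of _ w])
  then show *: "D2 w h = (\<Sum>i\<in>Basis. (w \<bullet> i) *\<^sub>R D2 i h)" for w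
    unfolding D2_def by (rule frechet_derivative_eqI)
  have "linear (\<lambda>w. \<Sum>i\<in>Basis. (w \<bullet> i) *\<^sub>R D2 i h)"
    by (rule linearI)
      (simp_all add: inner_left_distrib scaleR_left_distrib sum.distrib scaleR_sum_right)
  moreover have "(\<lambda>w. D2 w h) = (\<lambda>w. \<Sum>i\<in>Basis. (w \<bullet> i) *\<^sub>R D2 i h)"
    by (intro ext *)
  ultimately show "linear (\<lambda>w. D2 w h)" by simp
qed

text \<open>Both the base point \<open>P z\<close> and the direction \<open>A z\<close> move. In the
  basis expansion the direction enters through scalar factors only, so the product rule gives one
  term for each motion. This serves the transition maps of the tangent bundle
  (\<open>P = fst\<close>, \<open>A = snd\<close>) and the energy, where \<open>L\<close> is
  differentiated along the velocity of the point itself.\<close>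

lemma has_derivative_derivative_along:
  fixes g :: "'e::euclidean_space \<Rightarrow> 'f::real_normed_vector"
    and P A :: "'z::real_normed_vector \<Rightarrow> 'e"
  assumes C2: "Ck_on 2 S g" and "open S" and "P z \<in> S"
    and P: "bounded_linear P" and A: "bounded_linear A"
  shows "((\<lambda>z. frechet_derivative g (at (P z)) (A z)) has_derivative
     (\<lambda>h. frechet_derivative (\<lambda>y. frechet_derivative g (at y) (A z)) (at (P z)) (P h)
        + frechet_derivative g (at (P z)) (A h))) (at z)"
proof -
  have d1: "g differentiable (at y)" if "y \<in> S" for y
    using C2 that by (simp add: numeral_2_eq_2)
  have d2: "((\<lambda>y. frechet_derivative g (at y) w) has_derivative
      frechet_derivative (\<lambda>y. frechet_derivative g (at y) w) (at (P z))) (at (P z))" for w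
    using C2 \<open>P z \<in> S\<close> by (simp add: numeral_2_eq_2 frechet_derivative_works[symmetric])
  have d3: "((\<lambda>z. frechet_derivative g (at (P z)) w) has_derivative
      (\<lambda>h. frechet_derivative (\<lambda>y. frechet_derivative g (at y) w) (at (P z)) (P h))) (at z)" for w
    using has_derivative_compose[OF bounded_linear_imp_has_derivative[OF P] d2] .
  have A': "((\<lambda>z. A z \<bullet> i) has_derivative (\<lambda>h. A h \<bullet> i)) (at z)" for i
    by (intro derivative_intros bounded_linear_imp_has_derivative[OF A])
  have "((\<lambda>z. \<Sum>i\<in>Basis. (A z \<bullet> i) *\<^sub>R frechet_derivative g (at (P z)) i) has_derivative
     (\<lambda>h. \<Sum>i\<in>Basis. (A z \<bullet> i) *\<^sub>R
          frechet_derivative (\<lambda>y. frechet_derivative g (at y) i) (at (P z)) (P h)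
        + (A h \<bullet> i) *\<^sub>R frechet_derivative g (at (P z)) i)) (at z)"
    by (intro has_derivative_sum has_derivative_scaleR A' d3)
  moreover have "open (P -` S)"
    using \<open>open S\<close> P continuous_on_open_vimage[of UNIV P] linear_continuous_on[OF P] by simp
  ultimately have "((\<lambda>z. frechet_derivative g (at (P z)) (A z)) has_derivative
     (\<lambda>h. \<Sum>i\<in>Basis. (A z \<bullet> i) *\<^sub>R
          frechet_derivative (\<lambda>y. frechet_derivative g (at y) i) (at (P z)) (P h)
        + (A h \<bullet> i) *\<^sub>R frechet_derivative g (at (P z)) i)) (at z)"
    using \<open>P z \<in> S\<close>
    by (elim has_derivative_transform_within_open)
      (auto simp: derivative_eq_sum_Basis[OF d1, of _ "A _"])
  then show ?thesis
    by (simp add: sum.distrib second_derivative_linear(1)[OF C2 \<open>open S\<close> \<open>P z \<in> S\<close>, of "A z"]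
        derivative_eq_sum_Basis[OF d1[OF \<open>P z \<in> S\<close>], of "A _"])
qed

section \<open>Local existence for autonomous differential equations with C^1 right-hand
  side\<close>

lemma C1_bounded_linear_compose:
  assumes C1: "Ck_on 1 S f" and A: "bounded_linear A"
  shows "Ck_on 1 S (\<lambda>x. A (f x))"
proof -
  have d: "((\<lambda>x. A (f x)) has_derivative (\<lambda>h. A (frechet_derivative f (at x) h))) (at x)"
    if "x \<in> S" for x
    using C1 that
    by (intro bounded_linear.has_derivative[OF A]) (simp add: frechet_derivative_works[symmetric])
  have "continuous_on S (\<lambda>x. A (frechet_derivative f (at x) v))" for v
    using C1 by (intro bounded_linear.continuous_on[OF A]) simp
  then have "continuous_on S (\<lambda>x. frechet_derivative (\<lambda>x. A (f x)) (at x) v)" for v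
    by (rule continuous_on_eq) (rule frechet_derivative_eqI[OF d, symmetric])
  moreover have "(\<lambda>x. A (f x)) differentiable (at x)" if "x \<in> S" for x
    using d[OF that] differentiable_def by blast
  ultimately show ?thesis by simp
qed

text \<open>The sum of the norms of the partial derivatives is continuous, hence bounded on the
  compact ball, and it dominates the operator norm; convexity of the ball then allows the mean value
  inequality.\<close>

lemma C1_lipschitz_on_ball:
  fixes f :: "'e::euclidean_space \<Rightarrow> 'f::real_normed_vector"
  assumes C1: "Ck_on 1 U f" and "open U" and "x0 \<in> U"
  obtains r K where "r > 0" "K > 0" "cball x0 r \<subseteq> U"
    "\<And>x y. x \<in> cball x0 r \<Longrightarrow> y \<in> cball x0 r \<Longrightarrow> dist (f x) (f y) \<le> K * dist x y"
proof -
  obtain r where r: "r > 0" "cball x0 r \<subseteq> U"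
    using \<open>open U\<close> \<open>x0 \<in> U\<close> open_contains_cball by blast
  have d: "(f has_derivative frechet_derivative f (at x)) (at x)" if "x \<in> U" for x
    using C1 that by (simp add: frechet_derivative_works[symmetric])
  have "continuous_on (cball x0 r) (\<lambda>x. \<Sum>i\<in>Basis. norm (frechet_derivative f (at x) i))"
    using C1 r by (intro continuous_intros) (auto intro: continuous_on_subset)
  then have "bounded ((\<lambda>x. \<Sum>i\<in>Basis. norm (frechet_derivative f (at x) i)) ` cball x0 r)"
    by (intro compact_imp_bounded compact_continuous_image) auto
  then obtain K where K: "K > 0"
    "\<And>x. x \<in> cball x0 r \<Longrightarrow> norm (\<Sum>i\<in>Basis. norm (frechet_derivative f (at x) i)) \<le> K"
    unfolding bounded_pos by blast
  have "norm (f x - f y) \<le> K * norm (x - y)" if "x \<in> cball x0 r" "y \<in> cball x0 r" for x y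
  proof (rule differentiable_bound[OF convex_cball _ _ that(1,2)])
    fix z assume z: "z \<in> cball x0 r"
    then show "(f has_derivative frechet_derivative f (at z)) (at z within cball x0 r)"
      using d r by (meson has_derivative_at_withinI subsetD)
    have "onorm (frechet_derivative f (at z)) \<le> (\<Sum>i\<in>Basis. norm (frechet_derivative f (at z) i))"
      using r z by (intro onorm_componentwise has_derivative_bounded_linear[OF d]) auto
    then show "onorm (frechet_derivative f (at z)) \<le> K" using K(2)[OF z] by simp
  qed
  then show thesis using r K(1) that by (simp add: dist_norm)
qed

text \<open>Picard iteration as a contraction of the bounded continuous functions on the line; functions
  on \<open>{-d..d}\<close> are extended constantly beyond the end points.\<close>

lemma lipschitz_ODE_solution:
  fixes g :: "'e::euclidean_space \<Rightarrow> 'e"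
  assumes "K > 0" and lip: "\<And>x y. dist (g x) (g y) \<le> K * dist x y"
    and d: "d > 0" "d * K < 1"
  obtains y where "y 0 = x0" "\<And>t. t \<in> {-d..d} \<Longrightarrow> (y has_vector_derivative g (y t)) (at t within {-d..d})"
proof -
  have g: "continuous_on S g" for S
    by (rule lipschitz_on_continuous_on[where L=K]) (use assms in \<open>auto simp: lipschitz_on_def\<close>)
  \<comment> \<open>The integrals start at \<open>-d\<close> rather than at 0, so that one formula
    covers times of either sign; the subtracted constant restores the value \<open>x0\<close> at
    0.\<close>
  define F where "F h t = x0 + integral {-d..t} (\<lambda>s. g (h s)) - integral {-d..0} (\<lambda>s. g (h s))"
    for h :: "real \<Rightarrow> 'e" and t
  have F: "(F h has_vector_derivative g (h t)) (at t within {-d..d})"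
    if "continuous_on {-d..d} h" "t \<in> {-d..d}" for h t
  proof -
    have "continuous_on {-d..d} (\<lambda>s. g (h s))"
      using that by (intro continuous_on_compose2[OF g]) auto
    from integral_has_vector_derivative[OF this that(2)]
    show ?thesis unfolding F_def[abs_def] by (auto intro!: derivative_eq_intros)
  qed
  have "\<exists>k :: real \<Rightarrow>\<^sub>C 'e. \<forall>t. k t = F h (clamp (-d) d t)" for h :: "real \<Rightarrow>\<^sub>C 'e"
  proof -
    have "continuous_on (cbox (-d) d) (F h)"
      using F[of h] by (intro continuous_on_vector_derivative) auto
    from continuous_on_cbox_bcontfunE[OF this] show ?thesis by metis
  qed
  then obtain T :: "(real \<Rightarrow>\<^sub>C 'e) \<Rightarrow> (real \<Rightarrow>\<^sub>C 'e)"
    where T: "\<And>h t. T h t = F h (clamp (-d) d t)" by metis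
  \<comment> \<open>\<open>F h\<close> and \<open>F k\<close> agree at 0 and their derivatives
    differ by at most \<open>K * dist h k\<close>; over a time of at most \<open>d\<close> this
    gives the factor \<open>d * K\<close>.\<close>
  have "dist (T h) (T k) \<le> (d * K) * dist h k" for h k
  proof (rule dist_bound)
    fix s :: real
    define t where "t = clamp (-d) d s"
    have t: "t \<in> {-d..d}" unfolding t_def using clamp_in_interval[of "-d" d s] d by simp
    have "norm ((F h t - F k t) - (F h 0 - F k 0)) \<le> (K * dist h k) * norm (t - 0)"
    proof (rule differentiable_bound[of "{-d..d}" "\<lambda>t. F h t - F k t"
            "\<lambda>t r. r *\<^sub>R (g (h t) - g (k t))"])
      fix u assume u: "u \<in> {-d..d}"
      have "((\<lambda>t. F h t - F k t) has_vector_derivative (g (h u) - g (k u))) (at u within {-d..d})"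
        by (intro derivative_intros F u) auto
      then show "((\<lambda>t. F h t - F k t) has_derivative (\<lambda>r. r *\<^sub>R (g (h u) - g (k u)))) (at u within {-d..d})"
        by (simp add: has_vector_derivative_def)
      have "norm (g (h u) - g (k u)) \<le> K * dist h k"
        using lip[of "h u" "k u"] dist_bounded[of h u k] \<open>K > 0\<close>
        by (simp add: dist_norm) (meson mult_left_mono less_imp_le order_trans)
      then show "onorm (\<lambda>r. r *\<^sub>R (g (h u) - g (k u))) \<le> K * dist h k"
        by (simp add: onorm_scaleR_left onorm_id)
    qed (use t d in auto)
    moreover have "F h 0 = F k 0" by (simp add: F_def)
    moreover have "(K * dist h k) * norm (t - 0) \<le> (K * dist h k) * d"
      using t \<open>K > 0\<close> by (intro mult_left_mono) auto
    ultimately show "dist (T h s) (T k s) \<le> (d * K) * dist h k"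
      by (simp add: T t_def[symmetric] dist_norm algebra_simps)
  qed
  then obtain y where y: "T y = y"
    using banach_fix_type[of "d * K" T] d \<open>K > 0\<close> by auto
  have y': "y t = F y t" if "t \<in> {-d..d}" for t
    using T[of y t] that y by simp
  show thesis
  proof
    show "y 0 = x0" using y'[of 0] d by (simp add: F_def)
    show "(y has_vector_derivative g (y t)) (at t within {-d..d})" if t: "t \<in> {-d..d}" for t
    proof (rule has_vector_derivative_transform[OF t y'])
      show "(F y has_vector_derivative g (y t)) (at t within {-d..d})"
        by (intro F t) simp
    qed
  qed
qed

text \<open>Precomposing \<open>f\<close> with the nearest-point projection onto a ball, which is
  1-Lipschitz, yields a globally Lipschitz field; its solution solves the original equation as long
  as it stays in that ball.\<close>

lemma C1_ODE_solution:
  fixes f :: "'e::euclidean_space \<Rightarrow> 'e"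
  assumes C1: "Ck_on 1 U f" and "open U" and "x0 \<in> U"
  obtains d y where "d > 0" "y 0 = x0"
    "\<And>t. t \<in> {-d<..<d} \<Longrightarrow> y t \<in> U \<and> (y has_vector_derivative f (y t)) (at t)"
proof -
  obtain r K where r: "r > 0" "K > 0" "cball x0 r \<subseteq> U"
    and lip: "\<And>x y. x \<in> cball x0 r \<Longrightarrow> y \<in> cball x0 r \<Longrightarrow> dist (f x) (f y) \<le> K * dist x y"
    using C1_lipschitz_on_ball[OF assms] by metis
  define B where "B = cball x0 r"
  have B: "convex B" "closed B" "B \<noteq> {}" using r by (auto simp: B_def)
  define g where "g x = f (closest_point B x)" for x
  have cp: "closest_point B x \<in> B" for x using B by (simp add: closest_point_in_set)
  have glip: "dist (g x) (g y) \<le> K * dist x y" for x y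
  proof -
    have "dist (g x) (g y) \<le> K * dist (closest_point B x) (closest_point B y)"
      unfolding g_def using cp lip by (simp add: B_def)
    also have "\<dots> \<le> K * dist x y" using closest_point_lipschitz[OF B] r by simp
    finally show ?thesis .
  qed
  define M where "M = norm (f x0) + K * r"
  have M: "norm (g x) \<le> M" for x
  proof -
    have "dist (g x) (f x0) \<le> K * dist (closest_point B x) x0"
      unfolding g_def using cp[of x] r lip by (simp add: B_def)
    also have "\<dots> \<le> K * r" using cp[of x] r by (simp add: B_def dist_commute)
    finally show ?thesis unfolding M_def
      by (metis add.commute dist_norm norm_triangle_sub add_left_mono order_trans)
  qed
  have "M > 0" unfolding M_def using r by (simp add: add_nonneg_pos)
  \<comment> \<open>The first bound makes \<open>d * K\<close> at most 1/2, so that the Picard map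
    contracts. The second keeps the solution, whose speed is at most \<open>M\<close>, within
    distance \<open>r\<close> of \<open>x0\<close>.\<close>
  define d where "d = min (1 / (2 * K)) (r / M)"
  have d: "d > 0" "d * K < 1" "d * M \<le> r"
  proof -
    show "d > 0" using r \<open>M > 0\<close> by (simp add: d_def)
    have "d * K \<le> (1 / (2 * K)) * K" unfolding d_def using r by (intro mult_right_mono) auto
    then show "d * K < 1" using r by simp
    have "d * M \<le> (r / M) * M" unfolding d_def using \<open>M > 0\<close> by (intro mult_right_mono) auto
    then show "d * M \<le> r" using \<open>M > 0\<close> by simp
  qed
  obtain y where y0: "y 0 = x0"
    and y: "\<And>t. t \<in> {-d..d} \<Longrightarrow> (y has_vector_derivative g (y t)) (at t within {-d..d})"
    using lipschitz_ODE_solution[OF \<open>K > 0\<close> glip d(1,2)] by metis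
  have yB: "y t \<in> B" if t: "t \<in> {-d..d}" for t
  proof -
    have "norm (y t - y 0) \<le> M * norm (t - 0)"
    proof (rule differentiable_bound[of "{-d..d}" y "\<lambda>t s. s *\<^sub>R g (y t)"])
      fix u assume "u \<in> {-d..d}"
      then show "(y has_derivative (\<lambda>s. s *\<^sub>R g (y u))) (at u within {-d..d})"
        using y by (simp add: has_vector_derivative_def)
      show "onorm (\<lambda>s. s *\<^sub>R g (y u)) \<le> M" using M by (simp add: onorm_scaleR_left onorm_id)
    qed (use t d in auto)
    also have "\<dots> \<le> M * d" using t \<open>M > 0\<close> by auto
    finally show ?thesis using d y0 by (simp add: B_def dist_norm norm_minus_commute mult.commute)
  qed
  show thesis
  proof
    fix t assume t: "t \<in> {-d<..<d}"
    then have "at t within {-d..d} = at t"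
      by (intro at_within_interior) (simp add: interior_atLeastAtMost_real)
    moreover have "g (y t) = f (y t)"
      using yB[of t] t by (simp add: g_def closest_point_self)
    ultimately show "y t \<in> U \<and> (y has_vector_derivative f (y t)) (at t)"
      using y[of t] yB[of t] t r(3) by (auto simp: B_def)
  qed (use d y0 in auto)
qed

subsection \<open>Linear algebra\<close>

text \<open>The Riesz vector of \<open>B a\<close> depends linearly on \<open>a\<close>;
  nondegeneracy makes this endomorphism injective, hence surjective by finite dimension.\<close>

lemma nondegenerate_represents:
  fixes B :: "'e::euclidean_space \<Rightarrow> 'e \<Rightarrow> real"
  assumes B1: "\<And>b. linear (\<lambda>a. B a b)" and B2: "\<And>a. linear (B a)"
    and nondeg: "\<And>a. (\<And>b. B a b = 0) \<Longrightarrow> a = 0" and "linear f"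
  obtains a where "\<And>b. B a b = f b"
proof -
  have repr: "(\<Sum>i\<in>Basis. f i *\<^sub>R i) \<bullet> b = f b" if "linear f" for f :: "'e \<Rightarrow> real" and b
  proof -
    have "f b = f (\<Sum>i\<in>Basis. (b \<bullet> i) *\<^sub>R i)" by (simp add: euclidean_representation)
    also have "\<dots> = (\<Sum>i\<in>Basis. (b \<bullet> i) * f i)"
      using that by (simp add: linear_sum linear_cmul)
    finally show ?thesis by (simp add: inner_sum_left inner_sum_right inner_commute mult.commute)
  qed
  define T where "T a = (\<Sum>i\<in>Basis. B a i *\<^sub>R i)" for a
  have T: "T a \<bullet> b = B a b" for a b unfolding T_def by (rule repr[OF B2])
  have lin: "linear T"
    unfolding T_def
    by (rule linearI) (simp_all add: linear_add[OF B1] linear_cmul[OF B1] scaleR_left_distrib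
        sum.distrib scaleR_sum_right)
  moreover have "inj T"
  proof (rule linear_injective_0[OF lin, THEN iffD2], intro allI impI)
    fix a assume "T a = 0" then have "B a b = 0" for b using T[of a b] by simp
    then show "a = 0" by (rule nondeg)
  qed
  ultimately have "surj T" by (simp add: linear_injective_imp_surjective)
  then obtain a where "T a = (\<Sum>i\<in>Basis. f i *\<^sub>R i)" by (metis surjD)
  then show thesis using that[of a] T repr[OF \<open>linear f\<close>] by metis
qed

text \<open>This is the Cartan 2-form at one point of the tangent bundle in natural coordinates: it
  pairs \<open>a\<close> and \<open>b\<close> to \<open>B (fst a) b - B (fst b) a\<close>, where
  \<open>B h\<close> is the differential of the fibre derivative of \<open>L\<close> in direction
  \<open>h\<close>. Both terms vanish on a pair of vertical vectors.\<close>

locale cartan_algebra =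
  fixes B :: "'e::euclidean_space \<Rightarrow> 'e \<times> 'e \<Rightarrow> real"
  assumes lin1: "linear (\<lambda>h. B h b)" and lin2: "linear (B h)"
    and nondeg: "(\<And>b. B (fst a) b - B (fst b) a = 0) \<Longrightarrow> a = 0"
begin

text \<open>On a vertical \<open>(0, a)\<close> the 2-form reduces to
  \<open>- B (fst b) (0, a)\<close>, so nondegeneracy concerns the second slot of \<open>B\<close>,
  while the claim concerns the first. Representation bridges the two: some \<open>a\<close>
  satisfies \<open>B b (0, a) = b \<bullet> h\<close> for all \<open>b\<close>, and
  \<open>b = h\<close> forces \<open>h \<bullet> h = 0\<close>.\<close>

lemma vertical_nondegenerate:
  assumes "\<And>k. B h (0, k) = 0"
  shows "h = 0"
proof -
  have "linear (\<lambda>a. B b (0, a))" for b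
    using linear_compose[OF _ lin2[of b], of "\<lambda>a. (0, a)"]
    by (simp add: o_def linear_iff)
  moreover have "a = 0" if "\<And>b. B b (0, a) = 0" for a
    using nondeg[of "(0, a)"] that linear_0[OF lin1] by (simp add: zero_prod_def)
  moreover have "linear (\<lambda>b. b \<bullet> h)" by (simp add: linear_iff inner_left_distrib)
  ultimately obtain a where "\<And>b. B b (0, a) = b \<bullet> h"
    using nondegenerate_represents[of "\<lambda>a b. B b (0, a)"] lin1 by metis
  then show "h = 0" using assms by (metis inner_eq_zero_iff)
qed

lemma represents:
  fixes f :: "'e \<times> 'e \<Rightarrow> real"
  assumes "linear f"
  obtains a where "\<And>b. B (fst a) b - B (fst b) a = f b"
proof -
  have "linear (\<lambda>a. B (fst a) b - B (fst b) a)" for b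
    by (rule linearI)
      (simp_all add: linear_add[OF lin1] linear_cmul[OF lin1] linear_add[OF lin2]
        linear_cmul[OF lin2] right_diff_distrib)
  moreover have "linear (\<lambda>b. B (fst a) b - B (fst b) a)" for a
    by (rule linearI)
      (simp_all add: linear_add[OF lin1] linear_cmul[OF lin1] linear_add[OF lin2]
        linear_cmul[OF lin2] right_diff_distrib)
  ultimately show thesis
    using nondegenerate_represents[of "\<lambda>a b. B (fst a) b - B (fst b) a" f] nondeg assms that
    by blast
qed

text \<open>The vertical space is Lagrangian, so a vertical vector that annihilates a complement of the
  vertical space annihilates everything.\<close>

lemma vertical_eq_0:
  fixes a :: "'e \<times> 'e"
  assumes "fst a = 0" and "\<And>h. \<exists>k. B (fst a) (h, k) - B h a = 0"
  shows "a = 0"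
proof (rule nondeg)
  fix b :: "'e \<times> 'e"
  \<comment> \<open>The first term vanishes for every \<open>k\<close>, since
    \<open>fst a = 0\<close>; the hypothesis thus says \<open>B h a = 0\<close> for all
    \<open>h\<close>.\<close>
  obtain k where "B 0 (fst b, k) - B (fst b) a = 0" using assms by metis
  then show "B (fst a) b - B (fst b) a = 0"
    using assms(1) linear_0[OF lin1] by simp
qed

end

subsection \<open>Change of charts\<close>

text \<open>The facts behind pointwise calculus in charts, abstracted so that the same lemmas apply
  to the base \<open>Q\<close> and to \<open>tbundle Q\<close>.\<close>

locale diff_atlas =
  fixes M :: "('a, 'e::euclidean_space) mfd"
  assumes inj_chart: "c \<in> atlas M \<Longrightarrow> inj_on (cmap c) (cdom c)"
    and open_overlap: "c \<in> atlas M \<Longrightarrow> c' \<in> atlas M \<Longrightarrow> open (cmap c ` (cdom c \<inter> cdom c'))"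
    and diff_transition: "c \<in> charts_at M p \<Longrightarrow> c' \<in> charts_at M p \<Longrightarrow>
      (cmap c' \<circ> cinv c) differentiable (at (cmap c p))"
    and points_eq: "points M = \<Union> (cdom ` atlas M)"
begin

lemma cinv_cmap [simp]: "c \<in> charts_at M p \<Longrightarrow> cinv c (cmap c p) = p"
  using inj_chart by (auto simp: charts_at_def cinv_def inv_into_f_f)

lemma open_image: "c \<in> atlas M \<Longrightarrow> open (cmap c ` cdom c)"
  using open_overlap[of c c] by simp

lemma some_chart: "p \<in> points M \<Longrightarrow> some_chart M p \<in> charts_at M p"
  unfolding some_chart_def by (rule someI_ex) (auto simp: points_eq charts_at_def)

lemma charts_at_points: "c \<in> charts_at M p \<Longrightarrow> p \<in> points M"
  by (auto simp: points_eq charts_at_def)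

lemma transition_has_derivative:
  "c \<in> charts_at M p \<Longrightarrow> c' \<in> charts_at M p \<Longrightarrow>
    (cmap c' \<circ> cinv c has_derivative frechet_derivative (cmap c' \<circ> cinv c) (at (cmap c p)))
      (at (cmap c p))"
  by (rule diff_transition[unfolded frechet_derivative_works])

text \<open>The chain rule through the transition map. The composite is known to agree with
  \<open>g \<circ> cinv c\<close> on the overlap only, as \<open>cinv\<close> is arbitrary outside
  chart images; openness of the overlap makes that enough.\<close>

lemma has_derivative_change_chart:
  assumes c: "c \<in> charts_at M p" "c' \<in> charts_at M p"
    and g: "(g \<circ> cinv c' has_derivative G) (at (cmap c' p))"
  shows "(g \<circ> cinv c has_derivative
    (\<lambda>h. G (frechet_derivative (cmap c' \<circ> cinv c) (at (cmap c p)) h))) (at (cmap c p))"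
proof -
  have "(cmap c' \<circ> cinv c has_derivative frechet_derivative (cmap c' \<circ> cinv c) (at (cmap c p)))
      (at (cmap c p))"
    by (rule transition_has_derivative[OF c])
  moreover have "(g \<circ> cinv c' has_derivative G) (at ((cmap c' \<circ> cinv c) (cmap c p)))"
    using g c by simp
  ultimately have "((g \<circ> cinv c') \<circ> (cmap c' \<circ> cinv c) has_derivative
      (G \<circ> frechet_derivative (cmap c' \<circ> cinv c) (at (cmap c p)))) (at (cmap c p))"
    by (rule diff_chain_at)
  then have "(g \<circ> cinv c has_derivative
    (G \<circ> frechet_derivative (cmap c' \<circ> cinv c) (at (cmap c p)))) (at (cmap c p))"
  proof (rule has_derivative_transform_within_open)
    show "open (cmap c ` (cdom c \<inter> cdom c'))" using c open_overlap by (simp add: charts_at_def)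
    show "cmap c p \<in> cmap c ` (cdom c \<inter> cdom c')" using c by (auto simp: charts_at_def)
    fix x assume "x \<in> cmap c ` (cdom c \<inter> cdom c')"
    then obtain q where "x = cmap c q" "c \<in> charts_at M q" "c' \<in> charts_at M q"
      using c by (auto simp: charts_at_def)
    then show "((g \<circ> cinv c') \<circ> (cmap c' \<circ> cinv c)) x = (g \<circ> cinv c) x" by simp
  qed
  then show ?thesis by (simp add: o_def)
qed

lemma transition_self:
  assumes c: "c \<in> charts_at M p"
  shows "frechet_derivative (cmap c \<circ> cinv c) (at (cmap c p)) h = h"
proof -
  have "frechet_derivative id (at (cmap c p)) = frechet_derivative (cmap c \<circ> cinv c) (at (cmap c p))"
  proof (rule frechet_derivative_transform_within_open)
    show "open (cmap c ` cdom c)" using c open_image by (simp add: charts_at_def)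
    show "cmap c p \<in> cmap c ` cdom c" using c by (auto simp: charts_at_def)
    fix x assume "x \<in> cmap c ` cdom c"
    then show "id x = (cmap c \<circ> cinv c) x" using c by (auto simp: cinv_def f_inv_into_f)
  qed (simp add: id_def)
  then show ?thesis by (metis frechet_derivative_id id_apply)
qed

text \<open>The cocycle law of the Jacobians; it makes \<open>coord_vec\<close> obey the
  transformation rule of tangent vectors.\<close>

lemma transition_comp:
  assumes "c \<in> charts_at M p" "c' \<in> charts_at M p" "c'' \<in> charts_at M p"
  shows "frechet_derivative (cmap c'' \<circ> cinv c) (at (cmap c p)) h =
    frechet_derivative (cmap c'' \<circ> cinv c') (at (cmap c' p))
      (frechet_derivative (cmap c' \<circ> cinv c) (at (cmap c p)) h)"
  by (rule frechet_derivative_eqI[OF has_derivative_change_chart[OF assms(1,2)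
        transition_has_derivative[OF assms(2,3)]]])

lemma coord_vec_same [simp]: "c \<in> charts_at M p \<Longrightarrow> coord_vec M p c h c = h"
  by (simp add: coord_vec_def transition_self)

lemma tspaceI:
  assumes "\<And>c. c \<notin> charts_at M p \<Longrightarrow> v c = 0"
    and "\<And>c c'. c \<in> charts_at M p \<Longrightarrow> c' \<in> charts_at M p \<Longrightarrow>
      v c' = frechet_derivative (cmap c' \<circ> cinv c) (at (cmap c p)) (v c)"
  shows "v \<in> tspace M p"
  unfolding tspace_def using assms by blast

lemma tspace_0: "v \<in> tspace M p \<Longrightarrow> c \<notin> charts_at M p \<Longrightarrow> v c = 0"
  unfolding tspace_def by blast

lemma coord_vec_tspace [simp]:
  assumes "c \<in> charts_at M p"
  shows "coord_vec M p c h \<in> tspace M p"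
proof (rule tspaceI)
  fix c' c'' assume "c' \<in> charts_at M p" "c'' \<in> charts_at M p"
  then show "coord_vec M p c h c'' =
      frechet_derivative (cmap c'' \<circ> cinv c') (at (cmap c' p)) (coord_vec M p c h c')"
    using transition_comp[OF assms, of c' c''] by (simp add: coord_vec_def)
qed (simp add: coord_vec_def)

lemma tspaceD:
  assumes "v \<in> tspace M p" "c \<in> charts_at M p" "c' \<in> charts_at M p"
  shows "v c' = frechet_derivative (cmap c' \<circ> cinv c) (at (cmap c p)) (v c)"
  using assms unfolding tspace_def by blast

lemma coord_vec_tspace_eq:
  assumes "v \<in> tspace M p" "c \<in> charts_at M p"
  shows "coord_vec M p c (v c) = v"
proof (rule ext)
  fix c'
  show "coord_vec M p c (v c) c' = v c'"
    using tspaceD[OF assms, of c'] tspace_0[OF assms(1), of c'] by (simp add: coord_vec_def)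
qed

lemma tspace_eqI:
  assumes "v \<in> tspace M p" "w \<in> tspace M p" "c \<in> charts_at M p" "v c = w c"
  shows "v = w"
  by (rule trans[OF coord_vec_tspace_eq[OF assms(1,3), symmetric, unfolded assms(4)]
        coord_vec_tspace_eq[OF assms(2,3)]])

text \<open>\<open>ext_deriv\<close> computes in a chart fixed by choice. The Jacobian that arises
  from changing the chart of the function is the one that transforms the components of
  \<open>v\<close>, so any chart may be used instead.\<close>

lemma ext_deriv_fun_form:
  assumes c: "c \<in> charts_at M p" and v: "v \<in> tspace M p"
    and f: "(f \<circ> cinv c has_derivative F) (at (cmap c p))"
  shows "ext_deriv M (fun_form f) p [v] = F (v c)"
proof -
  define s where "s = some_chart M p"
  have s: "s \<in> charts_at M p" unfolding s_def using c by (intro some_chart charts_at_points)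
  have "ext_deriv M (fun_form f) p [v] = frechet_derivative (f \<circ> cinv s) (at (cmap s p)) (v s)"
    by (simp add: ext_deriv_def Let_def s_def o_def)
  also have "\<dots> = F (frechet_derivative (cmap c \<circ> cinv s) (at (cmap s p)) (v s))"
    by (rule frechet_derivative_eqI[OF has_derivative_change_chart[OF s c f]])
  also have "\<dots> = F (v c)" using tspaceD[OF v s c] by simp
  finally show ?thesis .
qed

end

lemma form_eq_1:
  "form_eq M 1 \<alpha> \<beta> \<longleftrightarrow> (\<forall>p\<in>points M. \<forall>v\<in>tspace M p. \<alpha> p [v] = \<beta> p [v])"
proof -
  have "(\<forall>vs. length vs = 1 \<and> set vs \<subseteq> T \<longrightarrow> P vs) \<longleftrightarrow> (\<forall>v\<in>T. P [v])"
    for T :: "('a, 'b) tvec set" and P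
    by (intro iffI ballI) (simp, auto simp: length_Suc_conv)
  then show ?thesis by (simp only: form_eq_def)
qed

section \<open>Charts of a smooth manifold\<close>

locale smooth_mfd =
  fixes Q :: "('a, 'e::euclidean_space) mfd"
  assumes smooth: "smooth_manifold Q"
begin

lemma chart_dom_open: "c \<in> atlas Q \<Longrightarrow> openin (mtop Q) (cdom c)"
  and chart_image_open: "c \<in> atlas Q \<Longrightarrow> open (cmap c ` cdom c)"
  and chart_homeo: "c \<in> atlas Q \<Longrightarrow>
    homeomorphic_map (subtopology (mtop Q) (cdom c)) (top_of_set (cmap c ` cdom c)) (cmap c)"
  and chart_transition: "c \<in> atlas Q \<Longrightarrow> c' \<in> atlas Q \<Longrightarrow>
    Ck_on k (cmap c ` (cdom c \<inter> cdom c')) (cmap c' \<circ> cinv c)"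
  using smooth by (simp_all add: smooth_manifold_def smooth_on_def)

lemma topspace_chart: "c \<in> atlas Q \<Longrightarrow> topspace (subtopology (mtop Q) (cdom c)) = cdom c"
  by (simp add: Int_absorb1 openin_subset chart_dom_open)

lemma chart_inj: "c \<in> atlas Q \<Longrightarrow> inj_on (cmap c) (cdom c)"
  using homeomorphic_imp_injective_map[OF chart_homeo] topspace_chart by metis

lemma chart_open_map:
  assumes "c \<in> atlas Q" "openin (mtop Q) V" "V \<subseteq> cdom c"
  shows "open (cmap c ` V)"
proof -
  have "openin (subtopology (mtop Q) (cdom c)) V"
    using assms by (auto simp: openin_subtopology)
  then have "openin (top_of_set (cmap c ` cdom c)) (cmap c ` V)"
    using homeomorphic_map_openness_eq[OF chart_homeo[OF assms(1)]] by blast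
  then show ?thesis using openin_open_eq[OF chart_image_open[OF assms(1)]] by blast
qed

text \<open>\<open>cinv\<close> is a choice of preimages, so its continuity comes from identifying
  it, on the chart image, with the inverse supplied by the homeomorphism.\<close>

lemma continuous_map_cinv:
  assumes "c \<in> atlas Q"
  shows "continuous_map (top_of_set (cmap c ` cdom c)) (mtop Q) (cinv c)"
proof -
  obtain g where g: "homeomorphic_maps (subtopology (mtop Q) (cdom c))
      (top_of_set (cmap c ` cdom c)) (cmap c) g"
    using chart_homeo[OF assms] homeomorphic_map_maps by blast
  have "g y = cinv c y" if "y \<in> cmap c ` cdom c" for y
    using g that chart_inj[OF assms] topspace_chart[OF assms]
    by (auto simp: homeomorphic_maps_def cinv_def inv_into_f_f)
  moreover have "continuous_map (top_of_set (cmap c ` cdom c)) (mtop Q) g"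
    using g by (auto simp: homeomorphic_maps_def continuous_map_in_subtopology)
  ultimately show ?thesis by (auto elim: continuous_map_eq)
qed

sublocale diff_atlas Q
proof
  show "inj_on (cmap c) (cdom c)" if "c \<in> atlas Q" for c by (rule chart_inj[OF that])
  show "open (cmap c ` (cdom c \<inter> cdom c'))" if "c \<in> atlas Q" "c' \<in> atlas Q" for c c'
    using that by (intro chart_open_map openin_Int chart_dom_open) auto
  show "(cmap c' \<circ> cinv c) differentiable (at (cmap c p))"
    if "c \<in> charts_at Q p" "c' \<in> charts_at Q p" for c c' p
    using that chart_transition[of c c' 1] by (auto simp: charts_at_def)
  show "points Q = \<Union> (cdom ` atlas Q)"
    using smooth by (auto simp: smooth_manifold_def)
qed

subsection \<open>The tangent bundle\<close>

lemma atlas_tbundle: "atlas (tbundle Q) = tchart Q ` atlas Q"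
  by (simp add: tbundle_def)

lemma cdom_tchart: "u \<in> cdom (tchart Q c) \<longleftrightarrow> fst u \<in> cdom c \<and> snd u \<in> tspace Q (fst u)"
  by (auto simp: tchart_def)

lemma charts_at_tbundle:
  "C \<in> charts_at (tbundle Q) u \<longleftrightarrow>
    (\<exists>c\<in>charts_at Q (fst u). C = tchart Q c) \<and> snd u \<in> tspace Q (fst u)"
  unfolding charts_at_def atlas_tbundle using cdom_tchart by blast

lemma cmap_tchart: "cmap (tchart Q c) u = (cmap c (fst u), snd u c)"
  by (simp add: tchart_def case_prod_beta)

lemma points_tbundle: "points (tbundle Q) = \<Union> (cdom ` atlas (tbundle Q))"
proof -
  let ?\<B> = "{{u \<in> cdom (tchart Q c). cmap (tchart Q c) u \<in> W} | c W. c \<in> atlas Q \<and> open W}"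
  have "\<Union> ?\<B> = (\<Union>c\<in>atlas Q. cdom (tchart Q c))"
  proof (intro equalityI subsetI)
    fix u assume "u \<in> (\<Union>c\<in>atlas Q. cdom (tchart Q c))"
    then obtain c where c: "c \<in> atlas Q" "u \<in> cdom (tchart Q c)" by blast
    \<comment> \<open>Taking \<open>W\<close> to be everything exhibits the whole chart domain as a
      generating open set.\<close>
    then have "{u \<in> cdom (tchart Q c). cmap (tchart Q c) u \<in> UNIV} \<in> ?\<B>" by blast
    then show "u \<in> \<Union> ?\<B>" by (rule UnionI) (simp add: c)
  qed blast
  then show ?thesis by (simp add: tbundle_def topology_generated_by_topspace)
qed

lemma points_tbundle_iff: "u \<in> points (tbundle Q) \<longleftrightarrow> fst u \<in> points Q \<and> snd u \<in> tspace Q (fst u)"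
  unfolding points_tbundle points_eq by (auto simp: atlas_tbundle cdom_tchart)

lemma inj_tchart:
  assumes "c \<in> atlas Q"
  shows "inj_on (cmap (tchart Q c)) (cdom (tchart Q c))"
proof (rule inj_onI)
  fix u w assume u: "u \<in> cdom (tchart Q c)" "w \<in> cdom (tchart Q c)"
    and eq: "cmap (tchart Q c) u = cmap (tchart Q c) w"
  then have "fst u = fst w"
    using inj_onD[OF chart_inj[OF assms]] by (simp add: cdom_tchart cmap_tchart)
  moreover have "snd u = snd w"
    using u eq assms \<open>fst u = fst w\<close>
    by (intro tspace_eqI[of "snd u" "fst u" "snd w" c]) (simp_all add: cdom_tchart cmap_tchart charts_at_def)
  ultimately show "u = w" by (simp add: prod_eq_iff)
qed

lemma tchart_coord_vec:
  assumes "c \<in> charts_at Q p"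
  shows "cmap (tchart Q c) (p, coord_vec Q p c v) = (cmap c p, v)"
  using assms by (simp add: cmap_tchart)

lemma cinv_tchart:
  assumes "c \<in> charts_at Q p"
  shows "cinv (tchart Q c) (cmap c p, v) = (p, coord_vec Q p c v)"
proof -
  have "inv_into (cdom (tchart Q c)) (cmap (tchart Q c)) (cmap (tchart Q c) (p, coord_vec Q p c v))
      = (p, coord_vec Q p c v)"
    using assms by (intro inv_into_f_f inj_tchart) (auto simp: charts_at_def cdom_tchart)
  then show ?thesis by (simp add: tchart_coord_vec[OF assms] cinv_def)
qed

lemma tchart_image:
  assumes "c \<in> atlas Q" "c' \<in> atlas Q"
  shows "cmap (tchart Q c) ` (cdom (tchart Q c) \<inter> cdom (tchart Q c'))
    = cmap c ` (cdom c \<inter> cdom c') \<times> UNIV"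
proof (intro equalityI subsetI)
  fix z assume "z \<in> cmap c ` (cdom c \<inter> cdom c') \<times> (UNIV :: 'e set)"
  then obtain p v where p: "p \<in> cdom c" "p \<in> cdom c'" "z = (cmap c p, v)" by auto
  then have "c \<in> charts_at Q p" using assms by (simp add: charts_at_def)
  then show "z \<in> cmap (tchart Q c) ` (cdom (tchart Q c) \<inter> cdom (tchart Q c'))"
    using p tchart_coord_vec[of c p v]
    by (intro image_eqI[where x="(p, coord_vec Q p c v)"]) (auto simp: cdom_tchart)
qed (auto simp: cdom_tchart cmap_tchart)

text \<open>In natural coordinates a change of charts sends \<open>(x, v)\<close> to
  \<open>(\<phi> x, D\<phi> x v)\<close>, with \<phi> the transition map of the base; the second
  derivative of \<phi> comes from moving the base point below a fixed \<open>v\<close>.\<close>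

lemma has_derivative_tchart_transition:
  assumes c: "c \<in> charts_at Q p" "c' \<in> charts_at Q p"
  shows "(cmap (tchart Q c') \<circ> cinv (tchart Q c) has_derivative
    (\<lambda>h. (frechet_derivative (cmap c' \<circ> cinv c) (at (cmap c p)) (fst h),
      frechet_derivative (\<lambda>x. frechet_derivative (cmap c' \<circ> cinv c) (at x) v) (at (cmap c p)) (fst h)
      + frechet_derivative (cmap c' \<circ> cinv c) (at (cmap c p)) (snd h)))) (at (cmap c p, v))"
proof -
  let ?\<phi> = "cmap c' \<circ> cinv c" and ?S = "cmap c ` (cdom c \<inter> cdom c')"
  have atl: "c \<in> atlas Q" "c' \<in> atlas Q" using c by (simp_all add: charts_at_def)
  have p: "cmap c p \<in> ?S" using c by (auto simp: charts_at_def)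
  have S: "open ?S" using atl by (rule open_overlap)
  have "((\<lambda>z. frechet_derivative ?\<phi> (at (fst z)) (snd z)) has_derivative
     (\<lambda>h. frechet_derivative (\<lambda>x. frechet_derivative ?\<phi> (at x) v) (at (cmap c p)) (fst h)
        + frechet_derivative ?\<phi> (at (cmap c p)) (snd h))) (at (cmap c p, v))"
    using has_derivative_derivative_along[OF chart_transition[OF atl] S, of fst "(cmap c p, v)" snd] p
    by (simp add: bounded_linear_fst bounded_linear_snd)
  moreover have "((\<lambda>z. ?\<phi> (fst z)) has_derivative
      (\<lambda>h. frechet_derivative ?\<phi> (at (cmap c p)) (fst h))) (at (cmap c p, v))"
    using has_derivative_compose[OF bounded_linear_imp_has_derivative[OF bounded_linear_fst],
        of ?\<phi> _ "(cmap c p, v)"] transition_has_derivative[OF c] by (metis fst_conv)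
  ultimately have "((\<lambda>z. (?\<phi> (fst z), frechet_derivative ?\<phi> (at (fst z)) (snd z))) has_derivative
    (\<lambda>h. (frechet_derivative ?\<phi> (at (cmap c p)) (fst h),
      frechet_derivative (\<lambda>x. frechet_derivative ?\<phi> (at x) v) (at (cmap c p)) (fst h)
      + frechet_derivative ?\<phi> (at (cmap c p)) (snd h)))) (at (cmap c p, v))"
    by (intro has_derivative_Pair)
  then show ?thesis
  proof (rule has_derivative_transform_within_open)
    show "open (?S \<times> (UNIV :: 'e set))" using S by (simp add: open_Times)
    show "(cmap c p, v) \<in> ?S \<times> UNIV" using p by simp
    fix z assume "z \<in> ?S \<times> (UNIV :: 'e set)"
    then obtain q w where q: "q \<in> cdom c" "q \<in> cdom c'" "z = (cmap c q, w)" by auto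
    then have "c \<in> charts_at Q q" "c' \<in> charts_at Q q" using atl by (simp_all add: charts_at_def)
    then show "(?\<phi> (fst z), frechet_derivative ?\<phi> (at (fst z)) (snd z))
        = (cmap (tchart Q c') \<circ> cinv (tchart Q c)) z"
      by (simp add: q cinv_tchart cmap_tchart coord_vec_def)
  qed
qed

sublocale TQ: diff_atlas "tbundle Q"
proof
  show "inj_on (cmap C) (cdom C)" if "C \<in> atlas (tbundle Q)" for C
    using that inj_tchart by (auto simp: atlas_tbundle)
  show "open (cmap C ` (cdom C \<inter> cdom C'))"
    if C: "C \<in> atlas (tbundle Q)" "C' \<in> atlas (tbundle Q)" for C C'
  proof -
    obtain c c' where "c \<in> atlas Q" "c' \<in> atlas Q" "C = tchart Q c" "C' = tchart Q c'"
      using C unfolding atlas_tbundle by blast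
    then show ?thesis using open_overlap by (simp add: tchart_image open_Times)
  qed
  show "(cmap C' \<circ> cinv C) differentiable (at (cmap C u))"
    if C: "C \<in> charts_at (tbundle Q) u" "C' \<in> charts_at (tbundle Q) u" for C C' u
  proof -
    obtain c c' where "c \<in> charts_at Q (fst u)" "c' \<in> charts_at Q (fst u)"
      "C = tchart Q c" "C' = tchart Q c'"
      using C unfolding charts_at_tbundle by blast
    then show ?thesis
      using has_derivative_tchart_transition[of c "fst u" c' "snd u c"]
      by (auto simp: cmap_tchart differentiable_def)
  qed
qed (rule points_tbundle)

text \<open>The Jacobian is block triangular: base components change as on \<open>Q\<close>,
  whatever the fibre components, and vertical vectors change by the base Jacobian again. These two
  facts make the vertical endomorphism and the Liouville field independent of charts.\<close>

lemma tchart_transition_derivative: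
  assumes c: "c \<in> charts_at Q (fst u)" "c' \<in> charts_at Q (fst u)"
  shows "fst (frechet_derivative (cmap (tchart Q c') \<circ> cinv (tchart Q c)) (at (cmap (tchart Q c) u)) h)
      = frechet_derivative (cmap c' \<circ> cinv c) (at (cmap c (fst u))) (fst h)" (is ?A)
    and "frechet_derivative (cmap (tchart Q c') \<circ> cinv (tchart Q c)) (at (cmap (tchart Q c) u)) (0, k)
      = (0, frechet_derivative (cmap c' \<circ> cinv c) (at (cmap c (fst u))) k)" (is ?B)
proof -
  let ?\<phi> = "cmap c' \<circ> cinv c" and ?x = "cmap c (fst u)"
  let ?D2 = "frechet_derivative (\<lambda>x. frechet_derivative ?\<phi> (at x) (snd u c)) (at ?x)"
  have atl: "c \<in> atlas Q" "c' \<in> atlas Q" using c by (simp_all add: charts_at_def)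
  have *: "frechet_derivative (cmap (tchart Q c') \<circ> cinv (tchart Q c)) (at (cmap (tchart Q c) u))
    = (\<lambda>h. (frechet_derivative ?\<phi> (at ?x) (fst h),
        ?D2 (fst h) + frechet_derivative ?\<phi> (at ?x) (snd h)))"
    using frechet_derivative_at[OF has_derivative_tchart_transition[OF c, of "snd u c"]]
    by (simp add: cmap_tchart)
  show ?A by (simp add: *)
  have "frechet_derivative ?\<phi> (at ?x) 0 = 0"
    using diff_transition[OF c] by (intro linear_0 linear_frechet_derivative)
  moreover have "?D2 0 = 0"
  proof (intro linear_0 linear_frechet_derivative)
    show "(\<lambda>x. frechet_derivative ?\<phi> (at x) (snd u c)) differentiable (at ?x)"
      using chart_transition[OF atl, of 2] c by (auto simp: numeral_2_eq_2 charts_at_def)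
  qed
  ultimately show ?B by (simp add: *)
qed

lemma vertical_endo_tspace:
  assumes w: "w \<in> tspace (tbundle Q) u"
  shows "vertical_endo w \<in> tspace (tbundle Q) u"
proof (rule TQ.tspaceI)
  show "vertical_endo w C' = frechet_derivative (cmap C' \<circ> cinv C) (at (cmap C u)) (vertical_endo w C)"
    if C: "C \<in> charts_at (tbundle Q) u" "C' \<in> charts_at (tbundle Q) u" for C C'
  proof -
    obtain c c' where "c \<in> charts_at Q (fst u)" "c' \<in> charts_at Q (fst u)"
      "C = tchart Q c" "C' = tchart Q c'"
      using C unfolding charts_at_tbundle by blast
    then show ?thesis
      using TQ.tspaceD[OF w C] tchart_transition_derivative[of c u c']
      by (simp add: vertical_endo_def)
  qed
  show "vertical_endo w C = 0" if "C \<notin> charts_at (tbundle Q) u" for C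
    using TQ.tspace_0[OF w that] by (simp add: vertical_endo_def zero_prod_def)
qed

lemma liouville_tspace:
  assumes "u \<in> points (tbundle Q)"
  shows "snd (liouville Q u) \<in> tspace (tbundle Q) u"
proof (rule TQ.tspaceI)
  show "snd (liouville Q u) C'
      = frechet_derivative (cmap C' \<circ> cinv C) (at (cmap C u)) (snd (liouville Q u) C)"
    if C: "C \<in> charts_at (tbundle Q) u" "C' \<in> charts_at (tbundle Q) u" for C C'
  proof -
    obtain c c' where "c \<in> charts_at Q (fst u)" "c' \<in> charts_at Q (fst u)"
      "C = tchart Q c" "C' = tchart Q c'"
      using C unfolding charts_at_tbundle by blast
    then show ?thesis
      using assms C tspaceD[of "snd u" "fst u" c c'] tchart_transition_derivative(2)[of c u c' "snd u c"]
      by (simp add: liouville_def cmap_tchart points_tbundle_iff)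
  qed
qed (simp add: liouville_def)

end

subsection \<open>The Cartan forms in coordinates\<close>

locale lagrangian = smooth_mfd Q for Q :: "('a, 'e::euclidean_space) mfd" +
  fixes L :: "('a, 'e) tpoint \<Rightarrow> real"
  assumes regular: "regular_lagrangian Q L"
begin

abbreviation "TQ \<equiv> tbundle Q"

lemma L_Ck:
  assumes "C \<in> atlas TQ"
  shows "Ck_on k (cmap C ` cdom C) (L \<circ> cinv C)"
  using assms regular by (simp add: regular_lagrangian_def smooth_fun_def smooth_on_def)

lemma L_diff:
  assumes "C \<in> charts_at TQ u"
  shows "(L \<circ> cinv C has_derivative frechet_derivative (L \<circ> cinv C) (at (cmap C u))) (at (cmap C u))"
  using assms L_Ck[of C 1] by (auto simp: charts_at_def frechet_derivative_works[symmetric])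

text \<open>The freedom in \<open>C\<close> matters: the exterior derivative keeps one chart fixed
  while the point moves, whereas the definition of the 1-form selects a chart at each point.\<close>

lemma cartan_1form_eq:
  assumes C: "C \<in> charts_at TQ u" and w: "w \<in> tspace TQ u"
  shows "cartan_1form Q L u [w] = frechet_derivative (L \<circ> cinv C) (at (cmap C u)) (0, fst (w C))"
  using TQ.ext_deriv_fun_form[OF C vertical_endo_tspace[OF w] L_diff[OF C]]
  by (simp add: cartan_1form_def vertical_endo_def)

lemma energy_eq:
  assumes C: "C \<in> charts_at TQ u"
  shows "energy Q L u = frechet_derivative (L \<circ> cinv C) (at (cmap C u)) (0, snd (cmap C u)) - L u"
  using TQ.ext_deriv_fun_form[OF C liouville_tspace[OF TQ.charts_at_points[OF C]] L_diff[OF C]] C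
  by (simp add: energy_def contract_def liouville_def)

text \<open>\<open>hess u h b\<close> is the derivative along \<open>b\<close> of the fibre
  derivative of \<open>L\<close> in direction \<open>h\<close>. It contains the mixed second
  derivatives of \<open>L\<close> as well; the fibre Hessian is the part
  \<open>hess u h (0, k)\<close>.\<close>

definition hess :: "('a, 'e) tpoint \<Rightarrow> 'e \<Rightarrow> 'e \<times> 'e \<Rightarrow> real" where
  "hess u h = (let C = some_chart TQ u in
    frechet_derivative (\<lambda>z. frechet_derivative (L \<circ> cinv C) (at z) (0, h)) (at (cmap C u)))"

lemma
  assumes C: "C \<in> charts_at TQ u"
  shows cmap_in_image: "cmap C u \<in> cmap C ` cdom C" and cmap_image_open: "open (cmap C ` cdom C)"
  using assms TQ.open_image by (auto simp: charts_at_def)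

lemma hess_has_derivative:
  assumes u: "u \<in> points TQ"
  shows "((\<lambda>z. frechet_derivative (L \<circ> cinv (some_chart TQ u)) (at z) (0, h)) has_derivative hess u h)
    (at (cmap (some_chart TQ u) u))"
  using L_Ck[of "some_chart TQ u" 2] TQ.some_chart[OF u] cmap_in_image[OF TQ.some_chart[OF u]]
  by (simp add: hess_def Let_def charts_at_def numeral_2_eq_2 frechet_derivative_works[symmetric])

text \<open>The exterior derivative of the 1-form differentiates its value on \<open>w\<close> along
  \<open>v\<close>, which is \<open>hess u (fst w) (v C)\<close>, and subtracts the same with
  \<open>v\<close> and \<open>w\<close> exchanged; the minus sign in the definition of the 2-form
  reverses the order.\<close>

lemma cartan_2form_eq:
  assumes u: "u \<in> points TQ"
  defines "C \<equiv> some_chart TQ u"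
  shows "cartan_2form Q L u [v, w] = hess u (fst (v C)) (w C) - hess u (fst (w C)) (v C)"
proof -
  have C: "C \<in> charts_at TQ u" unfolding C_def by (rule TQ.some_chart[OF u])
  have "frechet_derivative (\<lambda>x. cartan_1form Q L (cinv C x) [coord_vec TQ (cinv C x) C h]) (at (cmap C u))
      = hess u (fst h)" for h
  proof -
    have "((\<lambda>x. cartan_1form Q L (cinv C x) [coord_vec TQ (cinv C x) C h]) has_derivative hess u (fst h))
        (at (cmap C u))"
    proof (rule has_derivative_transform_within_open)
      show "((\<lambda>z. frechet_derivative (L \<circ> cinv C) (at z) (0, fst h)) has_derivative hess u (fst h))
          (at (cmap C u))"
        unfolding C_def by (rule hess_has_derivative[OF u])
      show "open (cmap C ` cdom C)" "cmap C u \<in> cmap C ` cdom C"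
        using C by (rule cmap_image_open cmap_in_image)+
      fix x assume "x \<in> cmap C ` cdom C"
      then obtain q where "x = cmap C q" "C \<in> charts_at TQ q" using C by (auto simp: charts_at_def)
      then show "frechet_derivative (L \<circ> cinv C) (at x) (0, fst h)
          = cartan_1form Q L (cinv C x) [coord_vec TQ (cinv C x) C h]"
        by (simp add: cartan_1form_eq)
    qed
    then show ?thesis by (rule frechet_derivative_at[symmetric])
  qed
  then show ?thesis
    by (simp add: cartan_2form_def ext_deriv_def Let_def C_def[symmetric] numeral_2_eq_2 lessThan_Suc)
qed

text \<open>In \<Delta>(L) the velocity is both part of the base point and the direction, whence two
  terms. For vertical \<open>h\<close> the last two terms cancel and only \<open>hess\<close> at the
  velocity remains.\<close>

lemma energy_has_derivative:
  assumes u: "u \<in> points TQ"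
  defines "C \<equiv> some_chart TQ u"
  shows "(energy Q L \<circ> cinv C has_derivative
    (\<lambda>h. hess u (snd (cmap C u)) h + frechet_derivative (L \<circ> cinv C) (at (cmap C u)) (0, snd h)
        - frechet_derivative (L \<circ> cinv C) (at (cmap C u)) h)) (at (cmap C u))"
proof (rule has_derivative_transform_within_open)
  have C: "C \<in> charts_at TQ u" unfolding C_def by (rule TQ.some_chart[OF u])
  have "bounded_linear (\<lambda>z. (0, snd z) :: 'e \<times> 'e)"
    by (intro bounded_linear_Pair bounded_linear_zero bounded_linear_snd)
  then have "((\<lambda>z. frechet_derivative (L \<circ> cinv C) (at z) (0, snd z)) has_derivative
     (\<lambda>h. hess u (snd (cmap C u)) h + frechet_derivative (L \<circ> cinv C) (at (cmap C u)) (0, snd h)))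
       (at (cmap C u))"
    using has_derivative_derivative_along[OF L_Ck cmap_image_open[OF C] cmap_in_image[OF C]
      bounded_linear_ident] C
    by (simp add: hess_def Let_def C_def[symmetric] charts_at_def)
  then show "((\<lambda>z. frechet_derivative (L \<circ> cinv C) (at z) (0, snd z) - (L \<circ> cinv C) z) has_derivative
    (\<lambda>h. hess u (snd (cmap C u)) h + frechet_derivative (L \<circ> cinv C) (at (cmap C u)) (0, snd h)
        - frechet_derivative (L \<circ> cinv C) (at (cmap C u)) h)) (at (cmap C u))"
    by (intro has_derivative_diff L_diff C)
  show "open (cmap C ` cdom C)" "cmap C u \<in> cmap C ` cdom C"
    using C by (rule cmap_image_open cmap_in_image)+
  fix x assume "x \<in> cmap C ` cdom C"
  then obtain q where "x = cmap C q" "C \<in> charts_at TQ q" using C by (auto simp: charts_at_def)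
  then show "frechet_derivative (L \<circ> cinv C) (at x) (0, snd x) - (L \<circ> cinv C) x = (energy Q L \<circ> cinv C) x"
    by (simp add: energy_eq)
qed

lemma hess_algebra:
  assumes u: "u \<in> points TQ"
  shows "cartan_algebra (hess u)"
proof (rule cartan_algebra.intro)
  define C where "C = some_chart TQ u"
  have C: "C \<in> charts_at TQ u" unfolding C_def by (rule TQ.some_chart[OF u])
  have "linear (\<lambda>w. frechet_derivative (\<lambda>y. frechet_derivative (L \<circ> cinv C) (at y) w) (at (cmap C u)) b)" for b
    using C by (intro second_derivative_linear(2)[OF L_Ck cmap_image_open[OF C] cmap_in_image[OF C]])
      (simp add: charts_at_def)
  from linear_compose[OF _ this, of "\<lambda>h. (0, h)"]
  show "linear (\<lambda>h. hess u h b)" for b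
    by (simp add: hess_def Let_def C_def[symmetric] o_def linear_iff)
  show "linear (hess u h)" for h
    using hess_has_derivative[OF u] by (rule has_derivative_linear)
  fix a assume a: "\<And>b. hess u (fst a) b - hess u (fst b) a = 0"
  \<comment> \<open>Nondegeneracy is stated for tangent vectors, so the pair \<open>a\<close> is
    promoted to one; a test vector enters only through its component in \<open>C\<close>.\<close>
  have "coord_vec TQ u C a = (\<lambda>c. 0)"
    using regular u a TQ.coord_vec_tspace[OF C] cartan_2form_eq[OF u] C
    unfolding regular_lagrangian_def symplectic_form_def
    by (simp add: C_def[symmetric])
  then show "a = 0" using TQ.coord_vec_same[OF C] by metis
qed

subsection \<open>The Lagrangian vector field\<close>

abbreviation "Gam \<equiv> lagrangian_field Q L"

text \<open>The field is defined by \<open>SOME\<close>, so nothing is known of it before a section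
  satisfying the equation is exhibited. The condition is pointwise: nondegeneracy solves it at each
  point, and the solutions are collected by choice.\<close>

lemma lagrangian_field:
  assumes u: "u \<in> points TQ"
  shows "fst (Gam u) = u" and "snd (Gam u) \<in> tspace TQ u"
    and "w \<in> tspace TQ u \<Longrightarrow> cartan_2form Q L u [snd (Gam u), w] =
      ext_deriv TQ (fun_form (energy Q L)) u [w]"
proof -
  have "\<exists>g. g \<in> tspace TQ u \<and> (\<forall>w\<in>tspace TQ u. cartan_2form Q L u [g, w] =
      ext_deriv TQ (fun_form (energy Q L)) u [w])" if u: "u \<in> points TQ" for u
  proof -
    define C where "C = some_chart TQ u"
    have C: "C \<in> charts_at TQ u" unfolding C_def by (rule TQ.some_chart[OF u])
    obtain F where F: "(energy Q L \<circ> cinv C has_derivative F) (at (cmap C u))"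
      using energy_has_derivative[OF u] C_def by blast
    interpret cartan_algebra "hess u" by (rule hess_algebra[OF u])
    obtain a where a: "\<And>b. hess u (fst a) b - hess u (fst b) a = F b"
      using represents[OF has_derivative_linear[OF F]] by metis
    have "cartan_2form Q L u [coord_vec TQ u C a, w] = ext_deriv TQ (fun_form (energy Q L)) u [w]"
      if "w \<in> tspace TQ u" for w
      using TQ.ext_deriv_fun_form[OF C that F] C
      by (simp add: cartan_2form_eq[OF u] C_def[symmetric] a)
    then show ?thesis using TQ.coord_vec_tspace[OF C] by blast
  qed
  then obtain g where g: "\<And>u. u \<in> points TQ \<Longrightarrow> g u \<in> tspace TQ u \<and>
      (\<forall>w\<in>tspace TQ u. cartan_2form Q L u [g u, w] = ext_deriv TQ (fun_form (energy Q L)) u [w])"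
    by metis
  have "(\<forall>u\<in>points TQ. fst (Gam u) = u \<and> snd (Gam u) \<in> tspace TQ u) \<and>
     form_eq TQ 1 (contract Gam (cartan_2form Q L)) (ext_deriv TQ (fun_form (energy Q L)))"
    unfolding lagrangian_field_def
  proof (rule someI[where x="\<lambda>u. (u, g u)"])
    show "(\<forall>u\<in>points TQ. fst (u, g u) = u \<and> snd (u, g u) \<in> tspace TQ u) \<and>
     form_eq TQ 1 (contract (\<lambda>u. (u, g u)) (cartan_2form Q L)) (ext_deriv TQ (fun_form (energy Q L)))"
      unfolding form_eq_1 using g by (simp add: contract_def)
  qed
  then show "fst (Gam u) = u" "snd (Gam u) \<in> tspace TQ u"
    "w \<in> tspace TQ u \<Longrightarrow> cartan_2form Q L u [snd (Gam u), w] =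
      ext_deriv TQ (fun_form (energy Q L)) u [w]"
    unfolding form_eq_1 using u by (simp_all add: contract_def)
qed

text \<open>Paired with a vertical vector, the 2-form retains only the base component of the field
  and the differential of the energy only the velocity, both inside the fibre Hessian, whose
  nondegeneracy identifies them.\<close>

lemma lagrangian_field_second_order:
  assumes u: "u \<in> points TQ"
  defines "C \<equiv> some_chart TQ u"
  shows "fst (snd (Gam u) C) = snd (cmap C u)"
proof -
  have C: "C \<in> charts_at TQ u" unfolding C_def by (rule TQ.some_chart[OF u])
  interpret cartan_algebra "hess u" by (rule hess_algebra[OF u])
  let ?g = "snd (Gam u) C"
  have "hess u (fst ?g - snd (cmap C u)) (0, k) = 0" for k
  proof -
    let ?w = "coord_vec TQ u C (0, k)"
    have "cartan_2form Q L u [snd (Gam u), ?w] = ext_deriv TQ (fun_form (energy Q L)) u [?w]"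
      using TQ.coord_vec_tspace[OF C] by (intro lagrangian_field(3) u)
    also have "\<dots> = hess u (snd (cmap C u)) (0, k)"
      using TQ.ext_deriv_fun_form[OF C TQ.coord_vec_tspace[OF C]
          energy_has_derivative[OF u, folded C_def]] C by simp
    also have "cartan_2form Q L u [snd (Gam u), ?w] = hess u (fst ?g) (0, k)"
      using C by (simp add: cartan_2form_eq[OF u] C_def[symmetric] linear_0[OF lin1])
    finally show ?thesis by (simp add: linear_diff[OF lin1])
  qed
  then have "fst ?g - snd (cmap C u) = 0" by (rule vertical_nondegenerate)
  then show ?thesis by simp
qed

end

subsection \<open>Vector fields and their integral curves\<close>

locale lagrangian_with_field = lagrangian Q L
  for Q :: "('a, 'e::euclidean_space) mfd" and L +
  fixes X :: "'a \<Rightarrow> ('a, 'e) tpoint"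
  assumes field: "vector_field Q X"
begin

abbreviation "TX \<equiv> tmap Q TQ X"

lemma X_continuous: "continuous_map (mtop Q) (mtop TQ) X"
  and fst_X [simp]: "p \<in> points Q \<Longrightarrow> fst (X p) = p"
  using field by (auto simp: vector_field_def smooth_map_def)

lemma X_points: "p \<in> points Q \<Longrightarrow> X p \<in> points TQ"
  using X_continuous by (auto simp: continuous_map_def)

lemma X_tspace: "p \<in> points Q \<Longrightarrow> snd (X p) \<in> tspace Q p"
  using X_points[of p] by (simp add: points_tbundle_iff)

lemma X_Ck:
  "c \<in> atlas Q \<Longrightarrow> C \<in> atlas TQ \<Longrightarrow>
    Ck_on k (cmap c ` {p \<in> cdom c. X p \<in> cdom C}) (cmap C \<circ> X \<circ> cinv c)"
  using field unfolding vector_field_def smooth_map_def smooth_on_def by blast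

lemma X_diff:
  assumes c: "c \<in> charts_at Q p" and C: "C \<in> charts_at TQ (X p)"
  shows "(cmap C \<circ> X \<circ> cinv c has_derivative
    frechet_derivative (cmap C \<circ> X \<circ> cinv c) (at (cmap c p))) (at (cmap c p))"
proof -
  have "Ck_on 1 (cmap c ` {p \<in> cdom c. X p \<in> cdom C}) (cmap C \<circ> X \<circ> cinv c)"
    using c C by (intro X_Ck) (simp_all add: charts_at_def)
  then show ?thesis using c C by (auto simp: charts_at_def frechet_derivative_works[symmetric])
qed

lemma tchart_at_X:
  assumes "c \<in> charts_at Q p"
  shows "tchart Q c \<in> charts_at TQ (X p)"
  using assms charts_at_points[OF assms] X_tspace by (auto simp: charts_at_tbundle)

lemma chart_at_X:
  assumes "C \<in> charts_at TQ (X p)" "p \<in> points Q"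
  obtains b where "b \<in> charts_at Q p" "C = tchart Q b"
  using assms unfolding charts_at_tbundle fst_X[OF assms(2)] by blast

text \<open>\<open>C\<close> is a natural chart over some \<open>b\<close>, so \<open>X q\<close>
  lies in its domain whenever \<open>q\<close> lies in that of \<open>b\<close>. This provides the
  open set on which the composite of coordinate expressions is the expected map.\<close>

lemma has_derivative_along_X:
  assumes c: "c \<in> charts_at Q p" and C: "C \<in> charts_at TQ (X p)"
    and g: "(g \<circ> cinv C has_derivative G) (at (cmap C (X p)))"
  shows "(g \<circ> X \<circ> cinv c has_derivative
    (\<lambda>h. G (frechet_derivative (cmap C \<circ> X \<circ> cinv c) (at (cmap c p)) h))) (at (cmap c p))"
proof -
  obtain b where b: "b \<in> charts_at Q p" "C = tchart Q b"
    using chart_at_X[OF C charts_at_points[OF c]] .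
  have "(g \<circ> cinv C has_derivative G) (at ((cmap C \<circ> X \<circ> cinv c) (cmap c p)))" using g c by simp
  from diff_chain_at[OF X_diff[OF c C] this]
  have "((g \<circ> cinv C) \<circ> (cmap C \<circ> X \<circ> cinv c) has_derivative
    (\<lambda>h. G (frechet_derivative (cmap C \<circ> X \<circ> cinv c) (at (cmap c p)) h))) (at (cmap c p))"
    by (simp add: o_def)
  then show ?thesis
  proof (rule has_derivative_transform_within_open)
    show "open (cmap c ` (cdom c \<inter> cdom b))" using c b by (auto simp: charts_at_def intro: open_overlap)
    show "cmap c p \<in> cmap c ` (cdom c \<inter> cdom b)" using c b by (auto simp: charts_at_def)
    fix x assume "x \<in> cmap c ` (cdom c \<inter> cdom b)"
    then obtain q where q: "x = cmap c q" "c \<in> charts_at Q q" "b \<in> charts_at Q q"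
      using c b by (auto simp: charts_at_def)
    then have "C \<in> charts_at TQ (X q)" using tchart_at_X b by simp
    then show "((g \<circ> cinv C) \<circ> (cmap C \<circ> X \<circ> cinv c)) x = (g \<circ> X \<circ> cinv c) x" using q by simp
  qed
qed

section \<open>The tangent map of the vector field\<close>

lemma tmap_eq:
  assumes "C \<in> charts_at TQ (X p)"
  shows "TX p v C = frechet_derivative (cmap C \<circ> X \<circ> cinv (some_chart Q p))
      (at (cmap (some_chart Q p) p)) (v (some_chart Q p))"
  using assms by (simp add: tmap_def Let_def)

lemma tmap_tspace:
  assumes p: "p \<in> points Q"
  shows "TX p v \<in> tspace TQ (X p)"
proof (rule TQ.tspaceI)
  show "TX p v C' = frechet_derivative (cmap C' \<circ> cinv C) (at (cmap C (X p))) (TX p v C)"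
    if C: "C \<in> charts_at TQ (X p)" "C' \<in> charts_at TQ (X p)" for C C'
  proof -
    have "(cmap C' \<circ> cinv C has_derivative frechet_derivative (cmap C' \<circ> cinv C) (at (cmap C (X p))))
        (at (cmap C (X p)))"
      by (rule TQ.transition_has_derivative[OF C])
    from has_derivative_along_X[OF some_chart[OF p] C(1) this]
    show ?thesis unfolding tmap_eq[OF C(1)] tmap_eq[OF C(2)]
      by (rule frechet_derivative_eqI)
  qed
qed (simp add: tmap_def Let_def)

text \<open>\<open>X\<close> is a section, so projecting its coordinate expression to the base gives
  back a transition map; invariantly, \<open>T\<tau> \<circ> TX\<close> is the identity.\<close>

lemma fst_tmap:
  assumes p: "p \<in> points Q" and b: "b \<in> charts_at Q p" and v: "v \<in> tspace Q p"
  shows "fst (TX p v (tchart Q b)) = v b"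
proof -
  define c where "c = some_chart Q p"
  have c: "c \<in> charts_at Q p" unfolding c_def by (rule some_chart[OF p])
  let ?f = "cmap (tchart Q b) \<circ> X \<circ> cinv c"
  have "((\<lambda>x. fst (?f x)) has_derivative (\<lambda>h. fst (frechet_derivative ?f (at (cmap c p)) h))) (at (cmap c p))"
    by (intro has_derivative_fst X_diff c tchart_at_X b)
  then have "(cmap b \<circ> cinv c has_derivative (\<lambda>h. fst (frechet_derivative ?f (at (cmap c p)) h))) (at (cmap c p))"
  proof (rule has_derivative_transform_within_open)
    show "open (cmap c ` cdom c)" using c by (auto simp: charts_at_def intro: open_image)
    show "cmap c p \<in> cmap c ` cdom c" using c by (auto simp: charts_at_def)
    fix x assume "x \<in> cmap c ` cdom c"
    then obtain q where "x = cmap c q" "c \<in> charts_at Q q" using c by (auto simp: charts_at_def)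
    then show "fst (?f x) = (cmap b \<circ> cinv c) x"
      using charts_at_points by (simp add: cmap_tchart)
  qed
  from frechet_derivative_eqI[OF this, symmetric]
  have "fst (TX p v (tchart Q b)) = frechet_derivative (cmap b \<circ> cinv c) (at (cmap c p)) (v c)"
    unfolding tmap_eq[OF tchart_at_X[OF b]] c_def[symmetric] .
  then show ?thesis using tspaceD[OF v c b] by simp
qed

section \<open>Integral curves and their lifts to the tangent bundle\<close>

lemma curve_in_chart_nbhd:
  assumes \<gamma>: "integral_curve Q X I \<gamma>" and t: "t \<in> I" and c: "c \<in> charts_at Q (\<gamma> t)"
  shows "open {s \<in> I. \<gamma> s \<in> cdom c}"
proof -
  have "openin (mtop Q) (cdom c)" using c by (simp add: charts_at_def chart_dom_open)
  moreover have "continuous_map (top_of_set I) (mtop Q) \<gamma>"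
    using \<gamma> by (simp add: integral_curve_def differentiable_curve_def)
  ultimately have "openin (top_of_set I) {s \<in> topspace (top_of_set I). \<gamma> s \<in> cdom c}"
    by (rule openin_continuous_map_preimage[rotated])
  then show ?thesis using \<gamma> by (simp add: openin_open_eq integral_curve_def)
qed

lemma curve_points: "integral_curve Q X I \<gamma> \<Longrightarrow> t \<in> I \<Longrightarrow> \<gamma> t \<in> points Q"
  by (auto simp: integral_curve_def differentiable_curve_def continuous_map_def)

lemma curve_lift_derivative:
  assumes \<gamma>: "integral_curve Q X I \<gamma>" and t: "t \<in> I" and C: "C \<in> charts_at TQ (X (\<gamma> t))"
  shows "(cmap C \<circ> (X \<circ> \<gamma>) has_vector_derivative TX (\<gamma> t) (snd (X (\<gamma> t))) C) (at t)"
proof -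
  define c where "c = some_chart Q (\<gamma> t)"
  have c: "c \<in> charts_at Q (\<gamma> t)" unfolding c_def using curve_points[OF \<gamma> t] by (rule some_chart)
  have "(cmap c \<circ> \<gamma>) differentiable (at t)" "velocity Q \<gamma> t = X (\<gamma> t)"
    using \<gamma> t c by (auto simp: integral_curve_def differentiable_curve_def)
  moreover from this(2) have "vector_derivative (cmap c \<circ> \<gamma>) (at t) = snd (X (\<gamma> t)) c"
    using c by (auto simp: velocity_def dest!: arg_cong[where f="\<lambda>x. snd x c"])
  ultimately have "(cmap c \<circ> \<gamma> has_vector_derivative snd (X (\<gamma> t)) c) (at t)"
    by (metis vector_derivative_works)
  moreover have "(cmap C \<circ> X \<circ> cinv c has_derivative
    frechet_derivative (cmap C \<circ> X \<circ> cinv c) (at (cmap c (\<gamma> t)))) (at ((cmap c \<circ> \<gamma>) t))"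
    using X_diff[OF c C] by simp
  ultimately have "((cmap C \<circ> X \<circ> cinv c) \<circ> (cmap c \<circ> \<gamma>) has_vector_derivative
      TX (\<gamma> t) (snd (X (\<gamma> t))) C) (at t)"
    unfolding tmap_eq[OF C] c_def[symmetric]
    by (rule vector_derivative_diff_chain_within[OF _ has_derivative_at_withinI])
  then show ?thesis
  proof (rule has_vector_derivative_transform_within_open)
    show "open {s \<in> I. \<gamma> s \<in> cdom c}" by (rule curve_in_chart_nbhd[OF \<gamma> t c])
    show "t \<in> {s \<in> I. \<gamma> s \<in> cdom c}" using t c by (simp add: charts_at_def)
    fix s assume "s \<in> {s \<in> I. \<gamma> s \<in> cdom c}"
    then have "c \<in> charts_at Q (\<gamma> s)" using c by (simp add: charts_at_def)
    then show "((cmap C \<circ> X \<circ> cinv c) \<circ> (cmap c \<circ> \<gamma>)) s = (cmap C \<circ> (X \<circ> \<gamma>)) s" by simp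
  qed
qed

lemma curve_lift_velocity:
  assumes \<gamma>: "integral_curve Q X I \<gamma>" and t: "t \<in> I"
  shows "velocity TQ (X \<circ> \<gamma>) t = (X (\<gamma> t), TX (\<gamma> t) (snd (X (\<gamma> t))))"
proof -
  have "(if C \<in> charts_at TQ (X (\<gamma> t)) then vector_derivative (cmap C \<circ> (X \<circ> \<gamma>)) (at t) else 0)
      = TX (\<gamma> t) (snd (X (\<gamma> t))) C" for C
    using vector_derivative_at[OF curve_lift_derivative[OF \<gamma> t]] by (simp add: tmap_def Let_def)
  then show ?thesis by (simp add: velocity_def)
qed

lemma curve_lift_differentiable:
  assumes \<gamma>: "integral_curve Q X I \<gamma>"
  shows "differentiable_curve TQ I (X \<circ> \<gamma>)"
  unfolding differentiable_curve_def
proof (intro conjI ballI)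
  show "continuous_map (top_of_set I) (mtop TQ) (X \<circ> \<gamma>)"
    using \<gamma> X_continuous by (auto simp: integral_curve_def differentiable_curve_def intro: continuous_map_compose)
  show "(cmap C \<circ> (X \<circ> \<gamma>)) differentiable (at t)" if "t \<in> I" "C \<in> charts_at TQ ((X \<circ> \<gamma>) t)" for t C
    using differentiableI_vector[OF curve_lift_derivative[OF \<gamma> that(1)]] that(2) by simp
qed

lemma integral_curve_exists:
  assumes p: "p \<in> points Q"
  obtains I \<gamma> where "integral_curve Q X I \<gamma>" "(0::real) \<in> I" "\<gamma> 0 = p"
proof -
  define c where "c = some_chart Q p"
  have c: "c \<in> charts_at Q p" unfolding c_def using p by (rule some_chart)
  have catl: "c \<in> atlas Q" using c by (simp add: charts_at_def)
  let ?U = "cmap c ` cdom c"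
  \<comment> \<open>The fibre component of \<open>X\<close> in the chart \<open>c\<close>, which is
    the right-hand side of the differential equation to be solved.\<close>
  let ?f = "\<lambda>x. snd (X (cinv c x)) c"
  have "X q \<in> cdom (tchart Q c)" if "q \<in> cdom c" for q
    using tchart_at_X[of c q] catl that by (simp add: charts_at_def)
  then have "{p \<in> cdom c. X p \<in> cdom (tchart Q c)} = cdom c" by blast
  moreover have "tchart Q c \<in> atlas TQ" using catl by (simp add: atlas_tbundle)
  ultimately have C1: "Ck_on 1 ?U (cmap (tchart Q c) \<circ> X \<circ> cinv c)"
    using X_Ck[OF catl, of "tchart Q c" 1] by simp
  have "Ck_on 1 ?U (\<lambda>x. snd ((cmap (tchart Q c) \<circ> X \<circ> cinv c) x))"
    by (rule C1_bounded_linear_compose[OF C1 bounded_linear_snd])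
  then have "Ck_on 1 ?U ?f" by (simp add: cmap_tchart o_def)
  then obtain d y where d: "d > 0" "y 0 = cmap c p"
    and y: "\<And>t. t \<in> {-d<..<d} \<Longrightarrow> y t \<in> ?U \<and> (y has_vector_derivative ?f (y t)) (at t)"
    using C1_ODE_solution[of ?U ?f "cmap c p"] chart_image_open[OF catl] c
    by (auto simp: charts_at_def)
  define I where "I = {-d<..<d}"
  define \<gamma> where "\<gamma> = cinv c \<circ> y"
  have y_chart: "cmap c (\<gamma> t) = y t" "\<gamma> t \<in> cdom c" if "t \<in> I" for t
    using y[of t] that by (auto simp: I_def \<gamma>_def cinv_def f_inv_into_f inv_into_into)
  have cont: "continuous_map (top_of_set I) (mtop Q) \<gamma>"
    unfolding \<gamma>_def
  proof (rule continuous_map_compose[OF _ continuous_map_cinv[OF catl]])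
    have "continuous_on I y"
      using y by (intro continuous_at_imp_continuous_on ballI has_vector_derivative_continuous)
        (auto simp: I_def)
    then show "continuous_map (top_of_set I) (top_of_set ?U) y"
      using y by (auto simp: I_def)
  qed
  \<comment> \<open>\<open>velocity\<close> records the derivative in every chart at the point,
    while the equation was solved in \<open>c\<close> only; the components of \<open>X\<close> and
    the derivatives of the curve change by the same Jacobian.\<close>
  have vel: "(cmap c' \<circ> \<gamma> has_vector_derivative snd (X (\<gamma> t)) c') (at t)"
    if t: "t \<in> I" and c': "c' \<in> charts_at Q (\<gamma> t)" for t c'
  proof -
    have ct: "c \<in> charts_at Q (\<gamma> t)" using y_chart[OF t] catl by (simp add: charts_at_def)
    have "(y has_vector_derivative ?f (y t)) (at t)" using y t by (simp add: I_def)
    moreover have "(cmap c' \<circ> cinv c has_derivative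
        frechet_derivative (cmap c' \<circ> cinv c) (at (cmap c (\<gamma> t)))) (at (y t))"
      using transition_has_derivative[OF ct c'] y_chart[OF t] by simp
    ultimately have "((cmap c' \<circ> cinv c) \<circ> y has_vector_derivative
        frechet_derivative (cmap c' \<circ> cinv c) (at (cmap c (\<gamma> t))) (?f (y t))) (at t)"
      by (rule vector_derivative_diff_chain_within[OF _ has_derivative_at_withinI])
    moreover have "?f (y t) = snd (X (\<gamma> t)) c" by (simp add: \<gamma>_def)
    moreover have "(cmap c' \<circ> cinv c) \<circ> y = cmap c' \<circ> \<gamma>" by (simp add: \<gamma>_def comp_assoc)
    ultimately show ?thesis
      unfolding tspaceD[OF X_tspace[OF charts_at_points[OF ct]] ct c'] by (simp only:)
  qed
  have "velocity Q \<gamma> t = X (\<gamma> t)" if t: "t \<in> I" for t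
  proof -
    have pt: "\<gamma> t \<in> points Q"
      using y_chart[OF t] catl charts_at_points[of c "\<gamma> t"] by (simp add: charts_at_def)
    have "(if c' \<in> charts_at Q (\<gamma> t) then vector_derivative (cmap c' \<circ> \<gamma>) (at t) else 0)
        = snd (X (\<gamma> t)) c'" for c'
      using vector_derivative_at[OF vel[OF t]] tspace_0[OF X_tspace[OF pt]] by simp
    then show ?thesis using pt by (simp add: velocity_def prod_eq_iff)
  qed
  moreover have "differentiable_curve Q I \<gamma>"
    unfolding differentiable_curve_def using cont differentiableI_vector[OF vel] by blast
  ultimately have "integral_curve Q X I \<gamma>"
    by (simp add: integral_curve_def I_def is_interval_1)
  moreover have "0 \<in> I" using d by (simp add: I_def)
  moreover have "\<gamma> 0 = p" using d c by (simp add: \<gamma>_def)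
  ultimately show thesis by (rule that)
qed

subsection \<open>The Hamilton--Jacobi equation\<close>

lemma hamilton_jacobi_solution_iff:
  "hamilton_jacobi_solution Q L X \<longleftrightarrow> (\<forall>p\<in>points Q. TX p (snd (X p)) = snd (Gam (X p)))"
proof
  assume H: "hamilton_jacobi_solution Q L X"
  show "\<forall>p\<in>points Q. TX p (snd (X p)) = snd (Gam (X p))"
  proof
    fix p assume "p \<in> points Q"
    then obtain I \<gamma> where \<gamma>: "integral_curve Q X I \<gamma>" "(0::real) \<in> I" "\<gamma> 0 = p"
      by (rule integral_curve_exists)
    then have "velocity TQ (X \<circ> \<gamma>) 0 = Gam (X p)"
      using H by (auto simp: hamilton_jacobi_solution_def integral_curve_def)
    then show "TX p (snd (X p)) = snd (Gam (X p))"
      using curve_lift_velocity[OF \<gamma>(1,2)] \<gamma>(3) by (metis snd_conv)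
  qed
next
  assume H: "\<forall>p\<in>points Q. TX p (snd (X p)) = snd (Gam (X p))"
  show "hamilton_jacobi_solution Q L X"
    unfolding hamilton_jacobi_solution_def
  proof (intro allI impI)
    fix I \<gamma> assume \<gamma>: "integral_curve Q X I \<gamma>"
    have "velocity TQ (X \<circ> \<gamma>) t = Gam ((X \<circ> \<gamma>) t)" if t: "t \<in> I" for t
      using curve_lift_velocity[OF \<gamma> t] H curve_points[OF \<gamma> t]
        lagrangian_field(1)[OF X_points[OF curve_points[OF \<gamma> t]]]
      by (simp add: prod_eq_iff)
    then show "integral_curve TQ Gam I (X \<circ> \<gamma>)"
      using \<gamma> curve_lift_differentiable[OF \<gamma>] by (simp add: integral_curve_def)
  qed
qed

text \<open>With this, both sides of the Hamilton--Jacobi equation become pairings of the 2-form at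
  \<open>X p\<close> with \<open>TX p w\<close>, and can be compared by linear algebra at a single
  point.\<close>

lemma pullback_d_energy:
  assumes p: "p \<in> points Q"
  shows "ext_deriv Q (pullback Q TQ X (fun_form (energy Q L))) p [w]
    = cartan_2form Q L (X p) [snd (Gam (X p)), TX p w]"
proof -
  define c where "c = some_chart Q p"
  have c: "c \<in> charts_at Q p" unfolding c_def by (rule some_chart[OF p])
  define C where "C = some_chart TQ (X p)"
  have C: "C \<in> charts_at TQ (X p)" unfolding C_def by (rule TQ.some_chart[OF X_points[OF p]])
  obtain F where F: "(energy Q L \<circ> cinv C has_derivative F) (at (cmap C (X p)))"
    using energy_has_derivative[OF X_points[OF p]] C_def by blast
  have "ext_deriv Q (pullback Q TQ X (fun_form (energy Q L))) p [w]
      = frechet_derivative (energy Q L \<circ> X \<circ> cinv c) (at (cmap c p)) (w c)"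
    by (simp add: ext_deriv_def Let_def pullback_def c_def o_def)
  also have "\<dots> = F (TX p w C)"
    unfolding tmap_eq[OF C] c_def[symmetric]
    by (rule frechet_derivative_eqI[OF has_derivative_along_X[OF c C F]])
  also have "\<dots> = ext_deriv TQ (fun_form (energy Q L)) (X p) [TX p w]"
    using TQ.ext_deriv_fun_form[OF C tmap_tspace[OF p] F] by simp
  also have "\<dots> = cartan_2form Q L (X p) [snd (Gam (X p)), TX p w]"
    using lagrangian_field(3)[OF X_points[OF p] tmap_tspace[OF p]] by simp
  finally show ?thesis .
qed

lemma pointwise_equation_iff:
  assumes p: "p \<in> points Q"
  shows "(\<forall>w\<in>tspace Q p. cartan_2form Q L (X p) [TX p (snd (X p)), TX p w]
      = cartan_2form Q L (X p) [snd (Gam (X p)), TX p w])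
    \<longleftrightarrow> TX p (snd (X p)) = snd (Gam (X p))"
proof (intro iffI)
  assume H: "\<forall>w\<in>tspace Q p. cartan_2form Q L (X p) [TX p (snd (X p)), TX p w]
      = cartan_2form Q L (X p) [snd (Gam (X p)), TX p w]"
  define u where "u = X p"
  define C where "C = some_chart TQ u"
  have u: "u \<in> points TQ" unfolding u_def by (rule X_points[OF p])
  have C: "C \<in> charts_at TQ u" unfolding C_def by (rule TQ.some_chart[OF u])
  obtain b where b: "b \<in> charts_at Q p" "C = tchart Q b"
    using chart_at_X C p unfolding u_def by metis
  interpret cartan_algebra "hess u" by (rule hess_algebra[OF u])
  define v where "v = TX p (snd u)"
  let ?a = "v C - snd (Gam u) C"
  have "?a = 0"
  proof (rule vertical_eq_0)
    \<comment> \<open>Both base components equal the velocity of \<open>u\<close>: that of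
      \<open>v\<close> because \<open>X\<close> is a section and \<open>TX\<close> is applied to
      \<open>X p\<close> itself, that of the Lagrangian field by the second order property.\<close>
    have "fst (v C) = snd (cmap C u)"
      using fst_tmap[OF p b(1) X_tspace[OF p]] by (simp add: v_def u_def b(2) cmap_tchart)
    then show "fst ?a = 0"
      using lagrangian_field_second_order[OF u] by (simp add: C_def)
    fix h
    let ?w = "coord_vec Q p b h"
    \<comment> \<open>\<open>k\<close> is whatever fibre component \<open>TX\<close> produces above
      the base vector \<open>h\<close>; the linear algebra accepts any value.\<close>
    define k where "k = snd (TX p ?w C)"
    have w: "TX p ?w C = (h, k)"
      using fst_tmap[OF p b(1) coord_vec_tspace[OF b(1)], of h] b(1)
      by (simp add: b(2) prod_eq_iff k_def)
    have "cartan_2form Q L u [v, TX p ?w] = cartan_2form Q L u [snd (Gam u), TX p ?w]"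
      using H coord_vec_tspace[OF b(1)] by (simp add: v_def u_def)
    then have "hess u (fst (v C)) (h, k) - hess u h (v C)
        = hess u (fst (snd (Gam u) C)) (h, k) - hess u h (snd (Gam u) C)"
      by (simp add: cartan_2form_eq[OF u] C_def[symmetric] w)
    then have "hess u (fst ?a) (h, k) - hess u h ?a = 0"
      by (simp add: linear_diff[OF lin1] linear_diff[OF lin2])
    then show "\<exists>k. hess u (fst ?a) (h, k) - hess u h ?a = 0" by blast
  qed
  then have "v C = snd (Gam u) C" by simp
  then have "v = snd (Gam u)"
    using TQ.tspace_eqI[OF _ lagrangian_field(2)[OF u] C] tmap_tspace[OF p] by (simp add: v_def u_def)
  then show "TX p (snd (X p)) = snd (Gam (X p))" by (simp add: v_def u_def)
qed simp

theorem hamilton_jacobi: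
  "hamilton_jacobi_solution Q L X \<longleftrightarrow>
    form_eq Q 1 (contract X (pullback Q TQ X (cartan_2form Q L)))
      (ext_deriv Q (pullback Q TQ X (fun_form (energy Q L))))"
proof -
  have "form_eq Q 1 (contract X (pullback Q TQ X (cartan_2form Q L)))
      (ext_deriv Q (pullback Q TQ X (fun_form (energy Q L))))
    \<longleftrightarrow> (\<forall>p\<in>points Q. \<forall>w\<in>tspace Q p. cartan_2form Q L (X p) [TX p (snd (X p)), TX p w]
      = ext_deriv Q (pullback Q TQ X (fun_form (energy Q L))) p [w])"
    unfolding form_eq_1 by (simp add: contract_def pullback_def[of _ _ _ "cartan_2form Q L"])
  then show ?thesis
    using pullback_d_energy pointwise_equation_iff hamilton_jacobi_solution_iff by simp
qed

end

theorem theorem1: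
  fixes Q :: "('a, real ^ 'n) mfd"
    and L :: "('a, real ^ 'n) tpoint \<Rightarrow> real"
    and X :: "'a \<Rightarrow> ('a, real ^ 'n) tpoint"
  assumes "smooth_manifold Q"
    and "regular_lagrangian Q L"
    and "vector_field Q X"
  shows "hamilton_jacobi_solution Q L X \<longleftrightarrow>
    form_eq Q 1
      (contract X (pullback Q (tbundle Q) X (cartan_2form Q L)))
      (ext_deriv Q (pullback Q (tbundle Q) X (fun_form (energy Q L))))"
proof -
  interpret lagrangian_with_field Q L X by unfold_locales (fact assms)+
  show ?thesis by (rule hamilton_jacobi)
qed

end
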